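(* For any integer $n\ge 0$, there is a piecewise linear map whose Lyapunov spectrum has at least $n$ points of inflection.
   Context: Piecewise linear map: given an integer $q\ge 2$ and pairwise disjoint closed sub-intervals $X_1,\dots,X_q$ of $[0,1]$ with lengths $|X_i|>0$, a piecewise linear map with $q$ branches is a map $T:\bigcup_{i=1}^q X_i\to[0,1]$ whose restriction to each $X_i$ is an affine homeomorphism onto $[0,1]$ (so $|T'|=|X_i|^{-1}$ on $X_i$). Its invariant set is $X=\{x\in[0,1]:T^n(x)\in\bigcup_{i=1}^q X_i\text{ for all }n\ge0\}$, and $T$ is regarded as a dynamical system $T:X\to X$. Lyapunov spectrum: for $x\in X$ let $\lambda(x)=\lim_{n\to\infty}\frac1n\log|(T^n)'(x)|$ whenever this limit exists. The set $A$ of all values taken by $\lambda$ is a closed interval $[\alpha_{\min},\alpha_{\max}]$. The Lyapunov spectrum is $L:A\to\mathbb{R}$, $L(\alpha)=\dim_H\{x\in X:\lambda(x)\text{ exists and equals }\alpha\}$, where $\dim_H$ is Hausdorff dimension. $L$ is real analytic on $(\alpha_{\min},\alpha_{\max})$. A point of inflection of $L$ is a point $\alpha\in(\alpha_{\min},\alpha_{\max})$ with $L''(\alpha)=0$. *)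

theory Defs
  imports "HOL-Analysis.Analysis"
begin

text \<open>Hausdorff measure and dimension of subsets of a metric space. The summand
  \<open>diam(U) ^ s\<close> follows the usual convention that at \<open>s = 0\<close> it is 0 for the empty set and 1
  otherwise (note that \<open>0 powr 0 = 0\<close>). Covering sets are required to be bounded because
  \<^const>\<open>diameter\<close> is meaningless on unbounded sets.\<close>

definition diam_pow :: "real \<Rightarrow> 'a::metric_space set \<Rightarrow> ennreal" where
  "diam_pow s U = (if U = {} then 0 else if s = 0 then 1 else ennreal (diameter U powr s))"

definition hausdorff_premeasure :: "real \<Rightarrow> real \<Rightarrow> 'a::metric_space set \<Rightarrow> ennreal" where
  "hausdorff_premeasure s \<delta> S =
     (INF U \<in> {U :: nat \<Rightarrow> 'a set. S \<subseteq> (\<Union>i. U i) \<and> (\<forall>i. bounded (U i) \<and> diameter (U i) \<le> \<delta>)}.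
        \<Sum>i. diam_pow s (U i))"

definition hausdorff_measure :: "real \<Rightarrow> 'a::metric_space set \<Rightarrow> ennreal" where
  "hausdorff_measure s S = (SUP \<delta> \<in> {0<..}. hausdorff_premeasure s \<delta> S)"

definition hausdorff_dim :: "'a::metric_space set \<Rightarrow> ennreal" where
  "hausdorff_dim S = (INF s \<in> {s. 0 \<le> s \<and> hausdorff_measure s S = 0}. ennreal s)"

text \<open>A map defined on a set \<open>D\<close> is represented by a total function whose values outside \<open>D\<close>
  are irrelevant; below, \<open>D\<close> is the union of the branch intervals.\<close>

definition piecewise_linear_map :: "nat \<Rightarrow> (nat \<Rightarrow> real set) \<Rightarrow> (real \<Rightarrow> real) \<Rightarrow> bool" where
  "piecewise_linear_map q X T \<longleftrightarrow>
     q \<ge> 2 \<and>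
     (\<forall>i<q. \<exists>a b. a < b \<and> X i = {a..b} \<and> X i \<subseteq> {0..1}) \<and>
     disjoint_family_on X {..<q} \<and>
     (\<forall>i<q. (\<exists>c d. \<forall>x\<in>X i. T x = c * x + d) \<and> (\<exists>g. homeomorphism (X i) {0..1} T g))"

definition invariant_set :: "real set \<Rightarrow> (real \<Rightarrow> real) \<Rightarrow> real set" where
  "invariant_set D T = {x \<in> {0..1}. \<forall>n. (T ^^ n) x \<in> D}"

text \<open>The set on which the \<open>n\<close>-th iterate is defined. For a piecewise linear map it is a finite
  disjoint union of nondegenerate closed intervals, so the derivative of \<open>T ^^ n\<close> relative to it
  is unique; it is one-sided at endpoints.\<close>

definition iterate_dom :: "real set \<Rightarrow> (real \<Rightarrow> real) \<Rightarrow> nat \<Rightarrow> real set" where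
  "iterate_dom D T n = {x \<in> {0..1}. \<forall>k<n. (T ^^ k) x \<in> D}"

definition has_lyapunov_exponent :: "real set \<Rightarrow> (real \<Rightarrow> real) \<Rightarrow> real \<Rightarrow> real \<Rightarrow> bool" where
  "has_lyapunov_exponent D T x \<alpha> \<longleftrightarrow>
     (\<lambda>n. 1 / real n * ln \<bar>vector_derivative (T ^^ n) (at x within iterate_dom D T n)\<bar>)
       \<longlonglongrightarrow> \<alpha>"

definition lyapunov_values :: "real set \<Rightarrow> (real \<Rightarrow> real) \<Rightarrow> real set" where
  "lyapunov_values D T = {\<alpha>. \<exists>x \<in> invariant_set D T. has_lyapunov_exponent D T x \<alpha>}"

definition lyapunov_spectrum :: "real set \<Rightarrow> (real \<Rightarrow> real) \<Rightarrow> real \<Rightarrow> real" where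
  "lyapunov_spectrum D T \<alpha> =
     enn2real (hausdorff_dim {x \<in> invariant_set D T. has_lyapunov_exponent D T x \<alpha>})"

text \<open>The spectrum \<open>L\<close> is real analytic on the interior of its domain; \<open>L''(\<alpha>) = 0\<close> is stated with
  explicit differentiability, so that no unspecified value of \<^const>\<open>deriv\<close> can enter.\<close>

definition inflection_points :: "real set \<Rightarrow> (real \<Rightarrow> real) \<Rightarrow> real set" where
  "inflection_points D T =
     {\<alpha>. Inf (lyapunov_values D T) < \<alpha> \<and> \<alpha> < Sup (lyapunov_values D T) \<and>
         (\<forall>\<^sub>F t in nhds \<alpha>. lyapunov_spectrum D T field_differentiable at t) \<and>
         (deriv (lyapunov_spectrum D T) has_real_derivative 0) (at \<alpha>)}"

end

theory Submission
  imports Defs "HOL-Probability.Hoeffding"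
begin

text \<open>
  Fix branch lengths \<open>r\<^sub>i\<close> with sum below \<open>1\<close> and put \<open>P \<theta> = ln (\<Sum>i. r\<^sub>i powr (-\<theta>))\<close>, a convex function with
  derivatives \<open>A = P'\<close> and \<open>V = P''\<close>. At the exponents \<open>A \<theta>\<close> the spectrum is a
  Legendre transform (\<open>lyapunov_spectrum_mean_exponent\<close>):

    \<open>L (A \<theta>) = P \<theta> / A \<theta> - \<theta>\<close>.

  The upper bound covers a level set by those \<open>n\<close>-cylinders on which the average exponent is already
  nearly right at time \<open>n\<close>; their number and size are controlled by \<open>P\<close>
  (\<open>hausdorff_measure_level_eq_0\<close>). The lower bound uses the Bernoulli measure giving branch \<open>i\<close> the
  probability \<open>r\<^sub>i powr (-\<theta>) * exp (- P \<theta>)\<close>: by the law of large numbers it lives on the level set of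
  \<open>A \<theta>\<close>, and there the measure of a cylinder of length \<open>d\<close> is roughly \<open>d powr (P \<theta> / A \<theta> - \<theta>)\<close>. The gaps
  between the branches turn this into a bound for arbitrary covering sets
  (\<open>hausdorff_measure_level_neq_0\<close>).

  Differentiating along the parametrisation gives \<open>L' \<circ> A = - P / A\<^sup>2\<close> and
  \<open>L'' \<circ> A = (2 P V - A\<^sup>2) / (A\<^sup>3 V)\<close>. So \<open>A \<theta>\<close> is an inflection point as soon as \<open>2 P V = A\<^sup>2\<close> at \<open>\<theta>\<close>,
  and it suffices to make \<open>2 P V - A\<^sup>2\<close> change sign often. Where \<open>P\<close> is positive this is the sign of
  the second derivative of \<open>sqrt P\<close>: it is negative where \<open>P\<close> is affine, and positive where \<open>P\<close> is large
  and bends sharply. Hence \<open>P\<close> should be a large multiple of a convex polygon with many corners.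

  Such a \<open>P\<close> arises from repeated lengths. Take the length \<open>exp (- x (K\<^sup>2 + 1 + j))\<close> with multiplicity
  \<open>exp (x (K\<^sup>2 - j\<^sup>2))\<close> for \<open>j = 0, ..., K\<close>. Then \<open>exp (P \<theta>)\<close> is, up to the exponential of an affine
  function, the truncated theta series \<open>\<Sum>j\<le>K. exp (x (\<theta> j - j\<^sup>2))\<close>. At \<open>\<theta> = 2 i\<close> the term \<open>j = i\<close> dominates
  all others by a factor of at least \<open>exp x\<close>, so \<open>V\<close> is exponentially small (\<open>below_at_even\<close>); at \<open>\<theta> = 2 i + 1\<close> the
  terms \<open>i\<close> and \<open>i + 1\<close> tie and \<open>V\<close> is of order \<open>x\<^sup>2\<close> while \<open>P\<close> and \<open>A\<close> are of order \<open>x\<close>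
  (\<open>above_at_odd\<close>). For large \<open>x\<close> the sign alternates at \<open>0, 1, ..., 2 K\<close>, and the intermediate value
  theorem gives \<open>2 K\<close> inflection points.
\<close>

section \<open>A piecewise linear map with prescribed branch lengths\<close>

locale branch_lengths =
  fixes q :: nat and r :: "nat \<Rightarrow> real"
  assumes two_branches: "q \<ge> 2"
    and length_pos: "\<And>i. i < q \<Longrightarrow> 0 < r i"
    and length_sum: "(\<Sum>i<q. r i) < 1"
begin

text \<open>The part of the unit interval left over by the branches is divided into \<open>q\<close> equal gaps, one
  after each branch. A uniform gap is what makes distances between cylinders comparable to the
  cylinders themselves.\<close>

definition gap :: real where
  "gap = (1 - (\<Sum>i<q. r i)) / q"

definition left :: "nat \<Rightarrow> real" where
  "left i = (\<Sum>j<i. r j) + i * gap"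

definition X :: "nat \<Rightarrow> real set" where
  "X i = {left i .. left i + r i}"

definition branch :: "real \<Rightarrow> nat" where
  "branch x = (THE i. i < q \<and> x \<in> X i)"

definition T :: "real \<Rightarrow> real" where
  "T x = (x - left (branch x)) / r (branch x)"

abbreviation D :: "real set" where "D \<equiv> (\<Union>i<q. X i)"

abbreviation inv_set :: "real set" where "inv_set \<equiv> invariant_set D T"

definition code :: "real \<Rightarrow> nat \<Rightarrow> nat" where
  "code x n = branch ((T ^^ n) x)"

text \<open>The slope of the composed inverse branch coded by the first \<open>n\<close> digits, which is the length of
  the corresponding cylinder interval.\<close>

definition contraction :: "(nat \<Rightarrow> nat) \<Rightarrow> nat \<Rightarrow> real" where
  "contraction \<omega> n = (\<Prod>k<n. r (\<omega> k))"

lemma gap_pos: "0 < gap"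
  using two_branches length_sum by (simp add: gap_def)

lemma length_less_1: assumes "i < q" shows "r i < 1"
proof -
  have "r i \<le> (\<Sum>i<q. r i)"
    using assms length_pos by (intro member_le_sum) (auto intro: less_imp_le)
  then show ?thesis using length_sum by simp
qed

lemma left_separated:
  assumes "i < j" "j \<le> q"
  shows "left i + r i + gap \<le> left j"
proof -
  have "(\<Sum>k<Suc i. r k) \<le> (\<Sum>k<j. r k)"
    using assms length_pos by (intro sum_mono2) (auto intro: less_imp_le)
  moreover have "real (Suc i) * gap \<le> real j * gap"
    using assms gap_pos by (intro mult_right_mono) auto
  ultimately show ?thesis by (simp add: left_def algebra_simps)
qed

lemma left_nonneg: "i < q \<Longrightarrow> 0 \<le> left i"
  using gap_pos length_pos unfolding left_def
  by (intro add_nonneg_nonneg sum_nonneg) (auto intro: less_imp_le)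

lemma right_le_1: "i < q \<Longrightarrow> left i + r i \<le> 1"
proof -
  assume i: "i < q"
  have "left q = 1" using two_branches by (simp add: left_def gap_def)
  with left_separated[OF i order_refl] gap_pos show ?thesis by simp
qed

lemma X_separated:
  assumes "i < q" "j < q" "i \<noteq> j" "x \<in> X i" "y \<in> X j"
  shows "gap \<le> \<bar>x - y\<bar>"
proof (cases "i < j")
  case True
  then show ?thesis using left_separated[of i j] assms by (auto simp: X_def)
next
  case False
  then show ?thesis using left_separated[of j i] assms by (auto simp: X_def)
qed

lemma branch_eq: "i < q \<Longrightarrow> x \<in> X i \<Longrightarrow> branch x = i"
  unfolding branch_def
proof (rule the_equality)
  fix j assume "i < q" "x \<in> X i" "j < q \<and> x \<in> X j"
  then show "j = i" using X_separated[of i j x x] gap_pos by force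
qed auto

lemma branch_in: "x \<in> D \<Longrightarrow> branch x < q \<and> x \<in> X (branch x)"
  using branch_eq by auto

lemma T_eq: "i < q \<Longrightarrow> x \<in> X i \<Longrightarrow> T x = (x - left i) / r i"
  by (simp add: T_def branch_eq)

lemma T_in_unit: "x \<in> D \<Longrightarrow> T x \<in> {0..1}"
  using branch_in[of x] length_pos[of "branch x"] by (auto simp: T_def X_def)

lemma X_subset: "i < q \<Longrightarrow> X i \<subseteq> {0..1}"
  using left_nonneg right_le_1 by (force simp: X_def)

lemma piecewise_linear: "piecewise_linear_map q X T"
  unfolding piecewise_linear_map_def
proof (intro conjI allI impI)
  show "q \<ge> 2" by (rule two_branches)
  show "disjoint_family_on X {..<q}"
    unfolding disjoint_family_on_def using branch_eq by blast
next
  fix i assume i: "i < q"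
  show "\<exists>a b. a < b \<and> X i = {a..b} \<and> X i \<subseteq> {0..1}"
    using i length_pos X_subset by (intro exI[of _ "left i"] exI[of _ "left i + r i"]) (auto simp: X_def)
  show "\<exists>c d. \<forall>x\<in>X i. T x = c * x + d"
    using i by (intro exI[of _ "1 / r i"] exI[of _ "- left i / r i"]) (auto simp: T_eq diff_divide_distrib)
  have "homeomorphism (X i) {0..1} T (\<lambda>y. left i + r i * y)"
  proof (rule homeomorphismI)
    show "continuous_on (X i) T"
      using i by (subst continuous_on_cong[OF refl T_eq[OF i]]) (use length_pos[OF i] in \<open>auto intro!: continuous_intros\<close>)
    show "T ` X i \<subseteq> {0..1}" using T_in_unit i by blast
    show "(\<lambda>y. left i + r i * y) ` {0..1} \<subseteq> X i"
      using length_pos[OF i] by (auto simp: X_def mult_left_le)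
  next
    fix y :: real assume "y \<in> {0..1}"
    then have "left i + r i * y \<in> X i" using length_pos[OF i] by (auto simp: X_def mult_left_le)
    then show "T (left i + r i * y) = y" using i length_pos[OF i] by (simp add: T_eq)
  qed (use length_pos[OF i] in \<open>auto intro!: continuous_intros simp: T_eq[OF i]\<close>)
  then show "\<exists>g. homeomorphism (X i) {0..1} T g" by blast
qed

section \<open>Symbolic coding of the invariant set\<close>

lemma inv_setD: "x \<in> inv_set \<Longrightarrow> (T ^^ n) x \<in> D"
  by (simp add: invariant_set_def)

lemma inv_set_unit: "x \<in> inv_set \<Longrightarrow> (T ^^ n) x \<in> {0..1}"
  using T_in_unit[OF inv_setD[of x "n - 1"]] by (cases n) (auto simp: invariant_set_def)

lemma code_less: "x \<in> inv_set \<Longrightarrow> code x n < q"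
  unfolding code_def using inv_setD branch_in by blast

lemma code_in: "x \<in> inv_set \<Longrightarrow> (T ^^ n) x \<in> X (code x n)"
  unfolding code_def using inv_setD branch_in by blast

lemma contraction_pos: "(\<And>k. k < n \<Longrightarrow> \<omega> k < q) \<Longrightarrow> 0 < contraction \<omega> n"
  unfolding contraction_def using length_pos by (intro prod_pos) auto

lemma contraction_cong: "(\<And>k. k < n \<Longrightarrow> \<omega> k = \<omega>' k) \<Longrightarrow> contraction \<omega> n = contraction \<omega>' n"
  unfolding contraction_def by (intro prod.cong) auto

lemma contraction_Suc: "contraction \<omega> (Suc n) = contraction \<omega> n * r (\<omega> n)"
  by (simp add: contraction_def)

lemma contraction_Suc_shift: "contraction \<omega> (Suc n) = r (\<omega> 0) * contraction (\<lambda>k. \<omega> (Suc k)) n"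
  unfolding contraction_def by (rule prod.lessThan_Suc_shift)

text \<open>As long as two orbits stay in common branches, each step expands their distance by exactly the
  slope of the branch. Both the upper and the lower size estimates for cylinders come from this.\<close>

lemma dist_eq_contraction:
  assumes "x \<in> inv_set" "y \<in> inv_set" "\<And>k. k < n \<Longrightarrow> code x k = code y k"
  shows "\<bar>x - y\<bar> = contraction (code x) n * \<bar>(T ^^ n) x - (T ^^ n) y\<bar>"
  using assms(3)
proof (induction n)
  case 0
  then show ?case by (simp add: contraction_def)
next
  case (Suc n)
  let ?i = "code x n"
  have i: "?i < q" using code_less assms by blast
  have "(T ^^ n) y \<in> X ?i" using code_in[OF assms(2), of n] Suc.prems by simp
  moreover have "(T ^^ n) x \<in> X ?i" using code_in[OF assms(1)] .
  ultimately have "(T ^^ n) x - (T ^^ n) y = r ?i * ((T ^^ Suc n) x - (T ^^ Suc n) y)"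
    using i length_pos[OF i] by (simp add: T_eq field_simps)
  then have "\<bar>(T ^^ n) x - (T ^^ n) y\<bar> = r ?i * \<bar>(T ^^ Suc n) x - (T ^^ Suc n) y\<bar>"
    using length_pos[OF i] by (simp add: abs_mult)
  then show ?case using Suc by (simp add: contraction_Suc)
qed

lemma cylinder_diameter:
  assumes "x \<in> inv_set" "y \<in> inv_set" "\<And>k. k < n \<Longrightarrow> code x k = code y k"
  shows "\<bar>x - y\<bar> \<le> contraction (code x) n"
proof -
  have "\<bar>(T ^^ n) x - (T ^^ n) y\<bar> \<le> 1"
    using inv_set_unit[OF assms(1), of n] inv_set_unit[OF assms(2), of n] by auto
  then show ?thesis
    using dist_eq_contraction[OF assms] contraction_pos[of n "code x"] code_less[OF assms(1)]
    by (simp add: mult_left_le)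
qed

lemma cylinder_separation:
  assumes "x \<in> inv_set" "y \<in> inv_set" "\<And>k. k < n \<Longrightarrow> code x k = code y k" "code x n \<noteq> code y n"
  shows "gap * contraction (code x) n \<le> \<bar>x - y\<bar>"
proof -
  have "gap \<le> \<bar>(T ^^ n) x - (T ^^ n) y\<bar>"
    using X_separated code_less code_in assms by blast
  then show ?thesis
    using dist_eq_contraction[OF assms(1-3)] contraction_pos[of n "code x"] code_less[OF assms(1)]
    by (simp add: mult.commute mult_right_mono)
qed

definition longest :: real where "longest = Max (r ` {..<q})"

lemma longest_ge: "i < q \<Longrightarrow> r i \<le> longest"
  unfolding longest_def by (intro Max_ge) auto

lemma longest_bounds: "0 < longest" "longest < 1"
proof -
  have ne: "{..<q} \<noteq> {}" using two_branches by (auto simp: lessThan_empty_iff)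
  then have "longest \<in> r ` {..<q}" unfolding longest_def by (intro Max_in) auto
  then show "0 < longest" "longest < 1" using length_pos length_less_1 by auto
qed

lemma contraction_le: "(\<And>k. k < n \<Longrightarrow> \<omega> k < q) \<Longrightarrow> contraction \<omega> n \<le> longest ^ n"
proof -
  assume *: "\<And>k. k < n \<Longrightarrow> \<omega> k < q"
  have "contraction \<omega> n \<le> (\<Prod>k<n. longest)"
    unfolding contraction_def using * length_pos longest_ge by (intro prod_mono) (auto intro: less_imp_le)
  then show ?thesis by simp
qed

text \<open>Iterating \<open>y = left i + r i * T y\<close> along the digits expresses a point of the invariant set
  through its code; this series is the limit.\<close>

definition point :: "(nat \<Rightarrow> nat) \<Rightarrow> real" where
  "point \<omega> = (\<Sum>n. left (\<omega> n) * contraction \<omega> n)"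

context
  fixes \<omega> :: "nat \<Rightarrow> nat" assumes digits: "\<And>k. \<omega> k < q"
begin

lemma summable_point: "summable (\<lambda>n. left (\<omega> n) * contraction \<omega> n)"
proof (rule summable_comparison_test')
  show "summable (\<lambda>n. longest ^ n)" using longest_bounds by simp
  fix n :: nat
  have "left (\<omega> n) \<le> 1" using right_le_1[OF digits] length_pos[OF digits] by (smt (verit))
  then show "norm (left (\<omega> n) * contraction \<omega> n) \<le> longest ^ n"
    using left_nonneg[OF digits] contraction_le[of n \<omega>] contraction_pos[of n \<omega>] digits
    by (simp add: abs_mult) (smt (verit) mult_left_le_one_le)
qed

lemma point_unit: "point \<omega> \<in> {0..1}"
proof -
  have "(\<Sum>n<N. left (\<omega> n) * contraction \<omega> n) \<le> 1 - contraction \<omega> N" for N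
  proof (induction N)
    case 0 then show ?case by (simp add: contraction_def)
  next
    case (Suc N)
    have "(left (\<omega> N) + r (\<omega> N)) * contraction \<omega> N \<le> 1 * contraction \<omega> N"
      using right_le_1[OF digits] contraction_pos[of N \<omega>] digits by (intro mult_right_mono) (auto intro: less_imp_le)
    then show ?case using Suc by (simp add: contraction_Suc algebra_simps)
  qed
  then have "(\<Sum>n<N. left (\<omega> n) * contraction \<omega> n) \<le> 1" for N
    using contraction_pos[of N \<omega>] digits by (smt (verit))
  then have "point \<omega> \<le> 1" unfolding point_def by (intro suminf_le_const summable_point) 
  moreover have "0 \<le> point \<omega>" unfolding point_def
    using left_nonneg[OF digits] contraction_pos[of _ \<omega>] digits
    by (intro suminf_nonneg summable_point mult_nonneg_nonneg) (auto intro: less_imp_le)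
  ultimately show ?thesis by simp
qed

lemma point_rec: "point \<omega> = left (\<omega> 0) + r (\<omega> 0) * point (\<lambda>k. \<omega> (Suc k))"
proof -
  have s: "summable (\<lambda>n. left (\<omega> (Suc n)) * contraction \<omega> (Suc n))"
    using summable_point by (subst summable_Suc_iff)
  then have "summable (\<lambda>n. r (\<omega> 0) * (left (\<omega> (Suc n)) * contraction (\<lambda>k. \<omega> (Suc k)) n))"
    by (simp add: contraction_Suc_shift mult_ac)
  then have s': "summable (\<lambda>n. left (\<omega> (Suc n)) * contraction (\<lambda>k. \<omega> (Suc k)) n)"
    using length_pos[OF digits[of 0]] by (simp add: summable_mult_D)
  have "point \<omega> = (\<Sum>n. left (\<omega> (Suc n)) * contraction \<omega> (Suc n)) + left (\<omega> 0)"
    unfolding point_def using suminf_split_head[OF summable_point] by (simp add: contraction_def)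
  also have "(\<Sum>n. left (\<omega> (Suc n)) * contraction \<omega> (Suc n)) = (\<Sum>n. r (\<omega> 0) * (left (\<omega> (Suc n)) * contraction (\<lambda>k. \<omega> (Suc k)) n))"
    by (simp add: contraction_Suc_shift mult_ac)
  also have "\<dots> = r (\<omega> 0) * point (\<lambda>k. \<omega> (Suc k))"
    unfolding point_def by (rule suminf_mult[OF s'])
  finally show ?thesis by simp
qed

end

lemma point_in_X:
  assumes "\<And>k. \<omega> k < q" shows "point \<omega> \<in> X (\<omega> 0)"
  using point_rec[of \<omega>] point_unit[of "\<lambda>k. \<omega> (Suc k)"] assms length_pos[of "\<omega> 0"]
  by (auto simp: X_def mult_left_le)

lemma funpow_T_point:
  assumes "\<And>k. \<omega> k < q" shows "(T ^^ n) (point \<omega>) = point (\<lambda>k. \<omega> (n + k))"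
proof (induction n)
  case (Suc n)
  let ?\<omega> = "\<lambda>k. \<omega> (n + k)"
  have "T (point ?\<omega>) = point (\<lambda>k. ?\<omega> (Suc k))"
    using T_eq[OF _ point_in_X[of ?\<omega>]] point_rec[of ?\<omega>] assms length_pos[of "?\<omega> 0"]
    by simp
  then show ?case using Suc by simp
qed simp

text \<open>Every digit sequence is the code of a point, so a measure on sequences can be used on the invariant set.\<close>

lemma point_code:
  assumes "\<And>k. \<omega> k < q" shows "point \<omega> \<in> inv_set" "code (point \<omega>) = \<omega>"
proof -
  have *: "(T ^^ n) (point \<omega>) \<in> X (\<omega> n)" for n
    using point_in_X[of "\<lambda>k. \<omega> (n + k)"] assms by (simp add: funpow_T_point)
  show "point \<omega> \<in> inv_set"
    unfolding invariant_set_def using * point_unit[of \<omega>] assms by auto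
  show "code (point \<omega>) = \<omega>"
    unfolding code_def using branch_eq[OF assms *] by auto
qed

section \<open>The Lyapunov exponent as a Birkhoff average\<close>

lemma iterate_dom_Suc:
  "x \<in> iterate_dom D T (Suc n) \<longleftrightarrow> x \<in> D \<and> T x \<in> iterate_dom D T n"
proof -
  have "x \<in> {0..1}" "T x \<in> {0..1}" if "x \<in> D"
    using that X_subset T_in_unit by blast+
  moreover have "(\<forall>k<Suc n. (T ^^ k) x \<in> D) \<longleftrightarrow> x \<in> D \<and> (\<forall>k<n. (T ^^ k) (T x) \<in> D)"
    by (simp add: All_less_Suc2 funpow_Suc_right del: funpow.simps)
  ultimately show ?thesis unfolding iterate_dom_def by blast
qed

lemma inv_set_iterate_dom: "x \<in> inv_set \<Longrightarrow> x \<in> iterate_dom D T n"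
  by (simp add: invariant_set_def iterate_dom_def)

lemma code_T: "code (T x) k = code x (Suc k)"
  by (simp add: code_def funpow_Suc_right del: funpow.simps)

text \<open>A derivative relative to a set is unique only at limit points of the set. Limit points propagate
  through the affine inverse branches, starting from the unit interval.\<close>

lemma islimpt_iterate_dom: "x \<in> iterate_dom D T n \<Longrightarrow> x islimpt iterate_dom D T n"
proof (induction n arbitrary: x)
  case 0
  have "iterate_dom D T 0 = {0..1}" by (auto simp: iterate_dom_def)
  with 0 show ?case
    by (metis connected_imp_perfect connected_Icc atLeastAtMost_singleton_iff singletonD zero_neq_one atLeastAtMost_iff order_refl zero_le_one)
next
  case (Suc n)
  define i where "i = branch x"
  have x: "x \<in> D" "T x \<in> iterate_dom D T n" using Suc.prems by (auto simp: iterate_dom_Suc)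
  have i: "i < q" "x \<in> X i" using branch_in[OF x(1)] by (auto simp: i_def)
  note r = length_pos[OF i(1)]
  show ?case unfolding islimpt_approachable
  proof (intro allI impI)
    fix e :: real assume "e > 0"
    then have "e / r i > 0" using r by simp
    then obtain y where y: "y \<in> iterate_dom D T n" "y \<noteq> T x" "dist y (T x) < e / r i"
      using Suc.IH[OF x(2)] unfolding islimpt_approachable by blast
    define x' where "x' = left i + r i * y"
    have "y \<in> {0..1}" using y(1) by (simp add: iterate_dom_def)
    then have x': "x' \<in> X i" using r by (auto simp: x'_def X_def mult_left_le)
    have Tx': "T x' = y" using T_eq[OF i(1) x'] r by (simp add: x'_def)
    have "x' - x = r i * (y - T x)" using T_eq[OF i] r by (simp add: x'_def field_simps)
    then have "dist x' x = r i * dist y (T x)" using r by (simp add: dist_real_def abs_mult)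
    also have "\<dots> < e" using y(3) r by (simp add: field_simps)
    finally have "dist x' x < e" .
    moreover have "x' \<in> iterate_dom D T (Suc n)"
      unfolding iterate_dom_Suc using x' i(1) Tx' y(1) by auto
    moreover have "x' \<noteq> x" using Tx' y(2) by auto
    ultimately show "\<exists>x'\<in>iterate_dom D T (Suc n). x' \<noteq> x \<and> dist x' x < e" by blast
  qed
qed

text \<open>The gaps are essential here, also at endpoints of branches: within distance \<open>gap\<close> the domain
  meets no other branch, so \<open>T\<close> agrees with one affine map.\<close>

lemma has_derivative_T:
  assumes "x \<in> D"
  shows "(T has_real_derivative 1 / r (branch x)) (at x within D)"
proof -
  let ?i = "branch x"
  have i: "?i < q" "x \<in> X ?i" using branch_in[OF assms] by auto
  have "((\<lambda>y. (y - left ?i) / r ?i) has_real_derivative 1 / r ?i) (at x within D)"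
    using length_pos[OF i(1)] by (auto intro!: derivative_eq_intros)
  then show ?thesis
  proof (rule has_field_derivative_transform_within[OF _ gap_pos assms])
    fix y assume y: "y \<in> D" "dist y x < gap"
    have "branch y = ?i"
      using X_separated[of "branch y" ?i y x] branch_in[OF y(1)] i y(2) by (auto simp: dist_real_def)
    then show "(y - left ?i) / r ?i = T y" by (simp add: T_def)
  qed
qed

lemma has_derivative_funpow_T:
  "x \<in> iterate_dom D T n \<Longrightarrow>
     ((T ^^ n) has_real_derivative 1 / contraction (code x) n) (at x within iterate_dom D T n)"
proof (induction n arbitrary: x)
  case 0
  then show ?case by (auto simp: contraction_def id_def)
next
  case (Suc n)
  let ?S = "iterate_dom D T (Suc n)"
  have x: "x \<in> D" "T x \<in> iterate_dom D T n" using Suc.prems by (auto simp: iterate_dom_Suc)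
  have "((T ^^ n) has_real_derivative 1 / contraction (code (T x)) n) (at (T x) within T ` ?S)"
    by (rule has_field_derivative_subset[OF Suc.IH[OF x(2)]]) (auto simp: iterate_dom_Suc)
  moreover have "(T has_real_derivative 1 / r (branch x)) (at x within ?S)"
    by (rule has_field_derivative_subset[OF has_derivative_T[OF x(1)]]) (auto simp: iterate_dom_Suc)
  ultimately have "(T ^^ n \<circ> T has_real_derivative 1 / contraction (code (T x)) n * (1 / r (branch x))) (at x within ?S)"
    by (rule DERIV_image_chain)
  moreover have "contraction (code x) (Suc n) = r (branch x) * contraction (code (T x)) n"
    unfolding contraction_Suc_shift code_T by (simp add: code_def)
  ultimately show ?case by (simp add: funpow_Suc_right mult.commute o_def del: funpow.simps)
qed

definition log_slope :: "nat \<Rightarrow> real" where "log_slope i = - ln (r i)"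

definition birkhoff :: "(nat \<Rightarrow> nat) \<Rightarrow> nat \<Rightarrow> real" where
  "birkhoff \<omega> n = (\<Sum>k<n. log_slope (\<omega> k))"

lemma log_slope_pos: "i < q \<Longrightarrow> 0 < log_slope i"
  using length_pos length_less_1 by (simp add: log_slope_def)

lemma contraction_eq_exp:
  assumes "\<And>k. k < n \<Longrightarrow> \<omega> k < q"
  shows "contraction \<omega> n = exp (- birkhoff \<omega> n)"
proof -
  have "contraction \<omega> n = (\<Prod>k<n. exp (- log_slope (\<omega> k)))"
    unfolding contraction_def using assms length_pos by (intro prod.cong) (auto simp: log_slope_def)
  then show ?thesis by (simp add: birkhoff_def exp_sum flip: sum_negf)
qed

lemma lyapunov_iff:
  assumes "x \<in> inv_set"
  shows "has_lyapunov_exponent D T x \<alpha> \<longleftrightarrow> (\<lambda>n. birkhoff (code x) n / n) \<longlonglongrightarrow> \<alpha>"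
proof -
  have "vector_derivative (T ^^ n) (at x within iterate_dom D T n) = exp (birkhoff (code x) n)" for n
  proof -
    have x: "x \<in> iterate_dom D T n" by (rule inv_set_iterate_dom[OF assms])
    have "vector_derivative (T ^^ n) (at x within iterate_dom D T n) = 1 / contraction (code x) n"
      using islimpt_iterate_dom[OF x] has_derivative_funpow_T[OF x]
      by (intro vector_derivative_within)
        (auto simp: trivial_limit_within has_real_derivative_iff_has_vector_derivative)
    then show ?thesis using code_less[OF assms] by (simp add: contraction_eq_exp exp_minus divide_inverse)
  qed
  then show ?thesis unfolding has_lyapunov_exponent_def by simp
qed

abbreviation level :: "real \<Rightarrow> real set" where
  "level \<alpha> \<equiv> {x \<in> inv_set. has_lyapunov_exponent D T x \<alpha>}"

section \<open>The upper bound for the dimension of a level set\<close>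

definition partition_sum :: "real \<Rightarrow> real" where
  "partition_sum \<theta> = (\<Sum>i<q. exp (\<theta> * log_slope i))"

definition pressure :: "real \<Rightarrow> real" where
  "pressure \<theta> = ln (partition_sum \<theta>)"

lemma partition_sum_pos: "0 < partition_sum \<theta>"
  unfolding partition_sum_def using two_branches by (intro sum_pos) (auto simp: lessThan_empty_iff)

definition words :: "nat \<Rightarrow> (nat \<Rightarrow> nat) set" where
  "words n = PiE {..<n} (\<lambda>_. {..<q})"

text \<open>Multiplicativity: the product of \<open>n\<close> copies of the partition sum expands into a sum over words.\<close>

lemma sum_words_exp_birkhoff: "(\<Sum>w\<in>words n. exp (\<theta> * birkhoff w n)) = exp (n * pressure \<theta>)"
proof -
  have "(\<Sum>w\<in>words n. exp (\<theta> * birkhoff w n)) = (\<Sum>w\<in>words n. \<Prod>k<n. exp (\<theta> * log_slope (w k)))"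
    by (simp add: birkhoff_def sum_distrib_left exp_sum)
  also have "\<dots> = (\<Prod>k<n. \<Sum>i<q. exp (\<theta> * log_slope i))"
    unfolding words_def by (subst prod_sum_PiE) auto
  also have "\<dots> = exp (pressure \<theta>) ^ n"
    using partition_sum_pos[of \<theta>] by (simp add: pressure_def partition_sum_def)
  finally show ?thesis by (simp add: exp_of_nat_mult)
qed

text \<open>The part of a cylinder on which the average exponent at time \<open>n\<close> is within \<open>\<epsilon>\<close> of \<open>\<alpha>\<close>. The
  condition depends only on the word, so a cell is a whole cylinder or empty.\<close>

definition cell :: "real \<Rightarrow> real \<Rightarrow> nat \<Rightarrow> (nat \<Rightarrow> nat) \<Rightarrow> real set" where
  "cell \<alpha> \<epsilon> n w = {x \<in> inv_set. (\<forall>k<n. code x k = w k) \<and> \<bar>birkhoff (code x) n - n * \<alpha>\<bar> \<le> n * \<epsilon>}"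

lemma birkhoff_cong: "(\<And>k. k < n \<Longrightarrow> \<omega> k = \<omega>' k) \<Longrightarrow> birkhoff \<omega> n = birkhoff \<omega>' n"
  unfolding birkhoff_def by (intro sum.cong) auto

lemma diameter_cell:
  assumes "w \<in> words n"
  shows "bounded (cell \<alpha> \<epsilon> n w)" "diameter (cell \<alpha> \<epsilon> n w) \<le> contraction w n"
proof -
  show "bounded (cell \<alpha> \<epsilon> n w)"
    by (rule bounded_subset[of "{0..1}"]) (auto simp: cell_def invariant_set_def)
  show "diameter (cell \<alpha> \<epsilon> n w) \<le> contraction w n"
  proof (rule diameter_le)
    show "cell \<alpha> \<epsilon> n w \<noteq> {} \<or> 0 \<le> contraction w n"
      using assms contraction_pos[of n w] by (auto simp: words_def intro: less_imp_le)
    fix x y assume "x \<in> cell \<alpha> \<epsilon> n w" "y \<in> cell \<alpha> \<epsilon> n w"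
    then show "norm (x - y) \<le> contraction w n"
      using cylinder_diameter[of x y n] contraction_cong[of n "code x" w] by (auto simp: cell_def)
  qed
qed

text \<open>A nonempty cell of the word \<open>w\<close> has diameter at most \<open>exp (- birkhoff w n)\<close>, where the exponent is close to
  \<open>n * \<alpha>\<close>. Splitting \<open>- s = \<theta> - (s + \<theta>)\<close> leaves a factor \<open>exp (\<theta> * birkhoff w n)\<close>, which can be summed
  over words, and a factor depending on \<open>n\<close> alone.\<close>

lemma diam_pow_cell:
  assumes w: "w \<in> words n" and s: "s > 0"
  shows "diam_pow s (cell \<alpha> \<epsilon> n w)
    \<le> ennreal (exp (\<theta> * birkhoff w n) * exp (n * (\<bar>s + \<theta>\<bar> * \<epsilon> - (s + \<theta>) * \<alpha>)))"
proof (cases "cell \<alpha> \<epsilon> n w = {}")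
  case True
  then show ?thesis by (simp add: diam_pow_def)
next
  case False
  then obtain x where "x \<in> cell \<alpha> \<epsilon> n w" by auto
  then have dev: "\<bar>birkhoff w n - n * \<alpha>\<bar> \<le> n * \<epsilon>"
    using birkhoff_cong[of n "code x" w] by (auto simp: cell_def)
  have "- (s + \<theta>) * (birkhoff w n - n * \<alpha>) \<le> \<bar>s + \<theta>\<bar> * \<bar>birkhoff w n - n * \<alpha>\<bar>"
    by (metis abs_ge_self abs_mult abs_minus_cancel)
  also have "\<dots> \<le> \<bar>s + \<theta>\<bar> * (n * \<epsilon>)" using dev by (intro mult_left_mono) auto
  finally have *: "- s * birkhoff w n \<le> \<theta> * birkhoff w n + n * (\<bar>s + \<theta>\<bar> * \<epsilon> - (s + \<theta>) * \<alpha>)"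
    by (simp add: algebra_simps)
  have "diameter (cell \<alpha> \<epsilon> n w) powr s \<le> contraction w n powr s"
    using s diameter_cell[OF w] by (intro powr_mono2) (auto intro: diameter_ge_0)
  also have "\<dots> = exp (- s * birkhoff w n)"
    using w by (subst contraction_eq_exp) (auto simp: words_def exp_powr_real mult.commute)
  also have "\<dots> \<le> exp (\<theta> * birkhoff w n + n * (\<bar>s + \<theta>\<bar> * \<epsilon> - (s + \<theta>) * \<alpha>))"
    using * by simp
  finally show ?thesis using False s by (simp add: diam_pow_def exp_add ennreal_leI)
qed

lemma sum_diam_pow_cells:
  assumes s: "s > 0"
  shows "(\<Sum>w\<in>words n. diam_pow s (cell \<alpha> \<epsilon> n w))
    \<le> ennreal (exp (pressure \<theta> + \<bar>s + \<theta>\<bar> * \<epsilon> - (s + \<theta>) * \<alpha>) ^ n)"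
proof -
  have "(\<Sum>w\<in>words n. diam_pow s (cell \<alpha> \<epsilon> n w))
     \<le> (\<Sum>w\<in>words n. ennreal (exp (\<theta> * birkhoff w n) * exp (n * (\<bar>s + \<theta>\<bar> * \<epsilon> - (s + \<theta>) * \<alpha>))))"
    by (intro sum_mono diam_pow_cell s)
  also have "\<dots> = ennreal (exp (n * pressure \<theta>) * exp (n * (\<bar>s + \<theta>\<bar> * \<epsilon> - (s + \<theta>) * \<alpha>)))"
    by (subst sum_ennreal) (auto simp: sum_words_exp_birkhoff simp flip: sum_distrib_right)
  also have "\<dots> = ennreal (exp (pressure \<theta> + \<bar>s + \<theta>\<bar> * \<epsilon> - (s + \<theta>) * \<alpha>) ^ n)"
    by (simp add: algebra_simps flip: exp_add exp_of_nat_mult)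
  finally show ?thesis .
qed

text \<open>A point of the level set lies in cells of all large generations. Therefore the cells of
  generations at least \<open>M\<close>, taken all together, form a cover of the whole level set for every \<open>M\<close>,
  even though the averages do not converge uniformly.\<close>

lemma level_covered:
  assumes "\<epsilon> > 0" "x \<in> level \<alpha>"
  shows "\<exists>n\<ge>M. \<exists>w\<in>words n. x \<in> cell \<alpha> \<epsilon> n w"
proof -
  have x: "x \<in> inv_set" "(\<lambda>n. birkhoff (code x) n / n) \<longlonglongrightarrow> \<alpha>"
    using assms(2) lyapunov_iff by auto
  obtain N where N: "\<And>n. n \<ge> N \<Longrightarrow> \<bar>birkhoff (code x) n / n - \<alpha>\<bar> < \<epsilon>"
    using LIMSEQ_D[OF x(2) assms(1)] by auto
  define n where "n = Max {M, N, 1}"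
  have n: "n \<ge> M" "n \<ge> N" "n > 0" by (auto simp: n_def)
  have "\<bar>birkhoff (code x) n - n * \<alpha>\<bar> = n * \<bar>birkhoff (code x) n / n - \<alpha>\<bar>"
    using n(3) by (subst abs_of_nat[symmetric], subst abs_mult[symmetric]) (simp add: algebra_simps)
  also have "\<dots> \<le> n * \<epsilon>" using N[OF n(2)] by (intro mult_left_mono) auto
  finally have "x \<in> cell \<alpha> \<epsilon> n (restrict (code x) {..<n})"
    using x(1) by (auto simp: cell_def)
  moreover have "restrict (code x) {..<n} \<in> words n"
    using code_less[OF x(1)] by (auto simp: words_def)
  ultimately show ?thesis using n(1) by blast
qed

text \<open>The sizes of the cells of generation \<open>n\<close> sum to at most \<open>\<kappa> ^ n\<close>, so the whole cover is bounded by
  the tail of a geometric series.\<close>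

lemma premeasure_level_le:
  assumes s: "s > 0" and \<epsilon>: "\<epsilon> > 0"
    and \<kappa>_def: "\<kappa> = exp (pressure \<theta> + \<bar>s + \<theta>\<bar> * \<epsilon> - (s + \<theta>) * \<alpha>)" and \<kappa>: "\<kappa> < 1"
    and M: "longest ^ M \<le> \<delta>"
  shows "hausdorff_premeasure s \<delta> (level \<alpha>) \<le> ennreal (\<kappa> ^ M / (1 - \<kappa>))"
proof -
  have fin: "finite (words n)" for n by (auto simp: words_def intro: finite_PiE)
  then have "\<forall>n. \<exists>f. bij_betw f {..<card (words n)} (words n)"
    using ex_bij_betw_nat_finite by (metis lessThan_atLeast0)
  then obtain f where f: "\<And>n. bij_betw (f n) {..<card (words n)} (words n)" by metis
  \<comment> \<open>Row \<open>n\<close> enumerates the cells of generation \<open>M + n\<close>; the rows are then merged by \<open>prod_decode\<close>.\<close>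
  define V where "V = (\<lambda>(n, j). if j < card (words (M + n)) then cell \<alpha> \<epsilon> (M + n) (f (M + n) j) else {})"
  have V: "bounded (V p) \<and> diameter (V p) \<le> \<delta>" for p
  proof (cases p)
    case (Pair n j)
    let ?w = "f (M + n) j"
    show ?thesis
    proof (cases "j < card (words (M + n))")
      case True
      then have w: "?w \<in> words (M + n)" using f[of "M + n"] by (auto dest: bij_betwE)
      have "contraction ?w (M + n) \<le> longest ^ (M + n)"
        using w by (intro contraction_le) (auto simp: words_def)
      also have "\<dots> \<le> longest ^ M" using longest_bounds by (intro power_decreasing) auto
      finally show ?thesis using diameter_cell[OF w, of \<alpha> \<epsilon>] M True by (simp add: V_def Pair)
    next
      case False
      then show ?thesis using M zero_less_power[OF longest_bounds(1), of M] by (simp add: V_def Pair)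
    qed
  qed
  define g where "g n = (\<Sum>j. diam_pow s (V (n, j)))" for n
  have "g n \<le> ennreal (\<kappa> ^ M * \<kappa> ^ n)" for n
  proof -
    have "g n = (\<Sum>j<card (words (M + n)). diam_pow s (V (n, j)))"
      unfolding g_def by (rule suminf_finite) (auto simp: V_def diam_pow_def)
    also have "\<dots> = (\<Sum>j<card (words (M + n)). diam_pow s (cell \<alpha> \<epsilon> (M + n) (f (M + n) j)))"
      by (intro sum.cong) (auto simp: V_def)
    also have "\<dots> = (\<Sum>w\<in>words (M + n). diam_pow s (cell \<alpha> \<epsilon> (M + n) w))"
      by (rule sum.reindex_bij_betw[OF f])
    also have "\<dots> \<le> ennreal (\<kappa> ^ (M + n))"
      unfolding \<kappa>_def by (rule sum_diam_pow_cells[OF s])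
    finally show ?thesis by (simp add: power_add)
  qed
  then have "suminf g \<le> (\<Sum>n. ennreal (\<kappa> ^ M * \<kappa> ^ n))"
    by (intro suminf_le) auto
  also have "\<dots> = ennreal (\<Sum>n. \<kappa> ^ M * \<kappa> ^ n)"
    using \<kappa> by (intro suminf_ennreal2) (auto simp: \<kappa>_def intro!: summable_mult summable_geometric)
  also have "(\<Sum>n. \<kappa> ^ M * \<kappa> ^ n) = \<kappa> ^ M / (1 - \<kappa>)"
    using \<kappa> by (simp add: \<kappa>_def suminf_mult suminf_geometric summable_geometric)
  finally have "suminf g \<le> ennreal (\<kappa> ^ M / (1 - \<kappa>))" .
  moreover have "(\<Sum>i. diam_pow s (V (prod_decode i))) = suminf g"
    using suminf_ennreal_2dimen[of g "\<lambda>p. diam_pow s (V p)"] by (simp add: g_def)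
  moreover have "level \<alpha> \<subseteq> (\<Union>i. V (prod_decode i))"
  proof
    fix x assume "x \<in> level \<alpha>"
    then obtain n w where nw: "n \<ge> M" "w \<in> words n" "x \<in> cell \<alpha> \<epsilon> n w"
      using level_covered[OF \<epsilon>] by blast
    obtain j where j: "j < card (words n)" "f n j = w"
      using bij_betw_imp_surj_on[OF f] nw(2) by (metis (no_types) imageE lessThan_iff)
    have "x \<in> V (n - M, j)" using nw j by (simp add: V_def)
    then have "x \<in> V (prod_decode (prod_encode (n - M, j)))" by simp
    then show "x \<in> (\<Union>i. V (prod_decode i))" by blast
  qed
  ultimately show ?thesis
    unfolding hausdorff_premeasure_def using V
    by (intro INF_lower2[of "\<lambda>i. V (prod_decode i)"]) auto
qed

text \<open>For \<open>\<alpha> > 0\<close> the hypothesis says \<open>s > pressure \<theta> / \<alpha> - \<theta>\<close>, so the infimum over \<open>\<theta>\<close> of these bounds is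
  the Legendre transform. It is attained where \<open>mean_exponent \<theta> = \<alpha>\<close>, if there
  is such a \<open>\<theta>\<close>.\<close>

proposition hausdorff_measure_level_eq_0:
  assumes s: "s > 0" and less: "pressure \<theta> < (s + \<theta>) * \<alpha>"
  shows "hausdorff_measure s (level \<alpha>) = 0"
proof -
  \<comment> \<open>Small enough that the error \<open>\<bar>s + \<theta>\<bar> * \<epsilon>\<close> stays below the margin in the hypothesis.\<close>
  define \<epsilon> where "\<epsilon> = ((s + \<theta>) * \<alpha> - pressure \<theta>) / (\<bar>s + \<theta>\<bar> + 1)"
  define \<kappa> where "\<kappa> = exp (pressure \<theta> + \<bar>s + \<theta>\<bar> * \<epsilon> - (s + \<theta>) * \<alpha>)"
  have \<epsilon>: "\<epsilon> > 0" using less by (simp add: \<epsilon>_def)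
  have "(\<bar>s + \<theta>\<bar> + 1) * \<epsilon> = (s + \<theta>) * \<alpha> - pressure \<theta>"
    by (simp add: \<epsilon>_def add_nonneg_eq_0_iff)
  then have "pressure \<theta> + \<bar>s + \<theta>\<bar> * \<epsilon> - (s + \<theta>) * \<alpha> < 0" using \<epsilon> by (simp add: algebra_simps)
  then have \<kappa>: "0 < \<kappa>" "\<kappa> < 1" by (auto simp: \<kappa>_def)
  have "hausdorff_premeasure s \<delta> (level \<alpha>) \<le> 0" if "\<delta> > 0" for \<delta>
  proof -
    have "(\<lambda>M. \<kappa> ^ M / (1 - \<kappa>)) \<longlonglongrightarrow> 0 / (1 - \<kappa>)"
      using \<kappa> by (intro tendsto_divide LIMSEQ_power_zero tendsto_const) auto
    then have lim: "(\<lambda>M. ennreal (\<kappa> ^ M / (1 - \<kappa>))) \<longlonglongrightarrow> 0"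
      using tendsto_ennrealI by fastforce
    have "(\<lambda>M. longest ^ M) \<longlonglongrightarrow> 0"
      using longest_bounds by (intro LIMSEQ_power_zero) auto
    then have "eventually (\<lambda>M. longest ^ M < \<delta>) sequentially"
      using that by (rule order_tendstoD(2))
    then have "eventually (\<lambda>M. hausdorff_premeasure s \<delta> (level \<alpha>) \<le> ennreal (\<kappa> ^ M / (1 - \<kappa>))) sequentially"
      by (rule eventually_mono) (use premeasure_level_le[OF s \<epsilon> \<kappa>_def \<kappa>(2)] in auto)
    then show ?thesis
      using lim by (intro tendsto_lowerbound[OF lim]) auto
  qed
  then show ?thesis unfolding hausdorff_measure_def by (auto intro: SUP_eq_const simp: le_zero_eq)
qed

end

section \<open>The strong law of large numbers for bounded discrete variables\<close>

text \<open>Hoeffding's inequality makes the probability of a deviation of the average by \<open>\<epsilon>\<close> exponentially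
  small in \<open>n\<close>, hence summable, and the Borel-Cantelli lemma applies to each \<open>\<epsilon>\<close> of the form
  \<open>1 / (m + 1)\<close>.\<close>

lemma strong_law_bounded_pmf:
  fixes p :: "'a pmf" and f :: "'a \<Rightarrow> real"
  assumes bounds: "\<And>x. x \<in> set_pmf p \<Longrightarrow> f x \<in> {l..u}" and "l < u"
  shows "AE \<omega> in PiM (UNIV :: nat set) (\<lambda>_. measure_pmf p).
           (\<lambda>n. (\<Sum>k<n. f (\<omega> k)) / n) \<longlonglongrightarrow> measure_pmf.expectation p f"
proof -
  let ?P = "PiM (UNIV :: nat set) (\<lambda>_. measure_pmf p)"
  let ?m = "measure_pmf.expectation p f"
  interpret P: product_prob_space "\<lambda>_. measure_pmf p" "UNIV :: nat set" ..
  have comp: "(\<lambda>\<omega>. \<omega> k) \<in> measurable ?P (measure_pmf p)" for k by simp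
  have meas[measurable]: "(\<lambda>\<omega>. f (\<omega> k)) \<in> borel_measurable ?P" for k
    by (rule measurable_compose[OF comp]) simp
  have indep: "P.indep_vars (\<lambda>_. borel) (\<lambda>k \<omega>. f (\<omega> k)) UNIV"
  proof (rule P.indep_vars_compose2[where M' = "\<lambda>_. measure_pmf p"])
    have "distr ?P ?P (\<lambda>\<omega>. \<omega>) = ?P" by (rule distr_id2) simp
    also have "\<dots> = PiM UNIV (\<lambda>i. distr ?P (measure_pmf p) (\<lambda>\<omega>. \<omega> i))"
      by (subst distr_PiM_component) (auto intro: prob_space_measure_pmf)
    finally show "P.indep_vars (\<lambda>_. measure_pmf p) (\<lambda>k \<omega>. \<omega> k) UNIV"
      by (subst P.indep_vars_iff_distr_eq_PiM') (auto simp: restrict_def)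
  qed simp
  have expect: "P.expectation (\<lambda>\<omega>. f (\<omega> k)) = ?m" for k
  proof -
    have "?m = (\<integral>x. f x \<partial>distr ?P (measure_pmf p) (\<lambda>\<omega>. \<omega> k))"
      by (subst distr_PiM_component) (auto intro: prob_space_measure_pmf)
    then show ?thesis by (subst (asm) integral_distr) auto
  qed
  have AE_bounds: "AE \<omega> in ?P. f (\<omega> k) \<in> {l..u}" for k
    using AE_PiM_component[of UNIV "\<lambda>_. measure_pmf p" k "\<lambda>x. f x \<in> {l..u}"] bounds
    by (auto simp: AE_measure_pmf_iff intro: prob_space_measure_pmf)
  define dev where "dev \<epsilon> n = {\<omega> \<in> space ?P. \<bar>(\<Sum>k<n. f (\<omega> k)) - n * ?m\<bar> \<ge> n * \<epsilon>}" for \<epsilon> :: real and n :: nat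
  have dev[measurable]: "dev \<epsilon> n \<in> sets ?P" for \<epsilon> n
    unfolding dev_def by measurable
  have dev_le: "P.prob (dev \<epsilon> n) \<le> 2 * exp (- 2 * \<epsilon>\<^sup>2 / (u - l)\<^sup>2) ^ n" if "\<epsilon> > 0" for \<epsilon> n
  proof (cases "n = 0")
    case True
    then show ?thesis by (intro order_trans[OF P.prob_le_1]) simp
  next
    case False
    interpret H: Hoeffding_ineq ?P "{..<n}" "\<lambda>k \<omega>. f (\<omega> k)" "\<lambda>_. l" "\<lambda>_. u" "n * ?m"
      by unfold_locales (use indep AE_bounds expect in \<open>auto intro: P.indep_vars_subset\<close>)
    have "P.prob (dev \<epsilon> n) \<le> 2 * exp (- 2 * (n * \<epsilon>)\<^sup>2 / (\<Sum>k<n. (u - l)\<^sup>2))"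
      unfolding dev_def using H.Hoeffding_ineq_abs_ge[of "n * \<epsilon>"] that False \<open>l < u\<close> by simp
    also have "- 2 * (n * \<epsilon>)\<^sup>2 / (\<Sum>k<n. (u - l)\<^sup>2) = n * (- 2 * \<epsilon>\<^sup>2 / (u - l)\<^sup>2)"
      using False by (simp add: power2_eq_square)
    finally show ?thesis by (simp only: exp_of_nat_mult)
  qed
  have "AE \<omega> in ?P. \<forall>m. eventually (\<lambda>n. \<omega> \<in> space ?P - dev (1 / Suc m) n) sequentially"
  proof (subst AE_all_countable, intro allI borel_cantelli_AE1)
    fix m
    let ?\<epsilon> = "1 / real (Suc m)"
    show "summable (\<lambda>n. P.prob (dev ?\<epsilon> n))"
    proof (rule summable_comparison_test')
      show "summable (\<lambda>n. 2 * exp (- 2 * ?\<epsilon>\<^sup>2 / (u - l)\<^sup>2) ^ n)"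
        using \<open>l < u\<close> by (intro summable_mult summable_geometric) (auto simp: divide_neg_pos)
      show "norm (P.prob (dev ?\<epsilon> n)) \<le> 2 * exp (- 2 * ?\<epsilon>\<^sup>2 / (u - l)\<^sup>2) ^ n" for n
        using dev_le[of ?\<epsilon> n] by simp
    qed
  qed (auto simp: P.emeasure_eq_measure)
  then show ?thesis
  proof eventually_elim
    case (elim \<omega>)
    show ?case
    proof (rule LIMSEQ_I)
      fix e :: real assume "e > 0"
      then obtain m where m: "1 / real (Suc m) < e" using nat_approx_posE by blast
      obtain N where N: "\<And>n. n \<ge> N \<Longrightarrow> \<omega> \<in> space ?P - dev (1 / Suc m) n"
        using elim unfolding eventually_sequentially by blast
      have "norm ((\<Sum>k<n. f (\<omega> k)) / n - ?m) < e" if n: "n \<ge> max N 1" for n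
      proof -
        have "\<bar>(\<Sum>k<n. f (\<omega> k)) - n * ?m\<bar> < n * (1 / Suc m)"
          using N[of n] n by (auto simp: dev_def)
        also have "\<bar>(\<Sum>k<n. f (\<omega> k)) - n * ?m\<bar> = n * \<bar>(\<Sum>k<n. f (\<omega> k)) / n - ?m\<bar>"
          using n by (subst abs_of_nat[symmetric], subst abs_mult[symmetric]) (simp add: algebra_simps)
        finally show ?thesis using n m by (simp only: mult_less_cancel_left_pos real_norm_def)
      qed
      then show "\<exists>N. \<forall>n\<ge>N. norm ((\<Sum>k<n. f (\<omega> k)) / n - ?m) < e" by blast
    qed
  qed
qed

section \<open>The lower bound for the dimension of a level set\<close>

context branch_lengths begin

definition weight :: "real \<Rightarrow> nat \<Rightarrow> real" where
  "weight \<theta> i = exp (\<theta> * log_slope i) / partition_sum \<theta>"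

definition mean_exponent :: "real \<Rightarrow> real" where
  "mean_exponent \<theta> = (\<Sum>i<q. weight \<theta> i * log_slope i)"

lemma weight_pos: "0 < weight \<theta> i"
  using partition_sum_pos by (simp add: weight_def)

lemma sum_weight: "(\<Sum>i<q. weight \<theta> i) = 1"
  using partition_sum_pos[of \<theta>] by (simp add: weight_def partition_sum_def flip: sum_divide_distrib)

lemma weight_eq_exp: "weight \<theta> i = exp (\<theta> * log_slope i - pressure \<theta>)"
  using partition_sum_pos[of \<theta>] by (simp add: weight_def pressure_def exp_diff)

lemma mean_exponent_pos: "0 < mean_exponent \<theta>"
  unfolding mean_exponent_def using two_branches weight_pos log_slope_pos
  by (intro sum_pos) (auto simp: lessThan_empty_iff)

definition gibbs_pmf :: "real \<Rightarrow> nat pmf" where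
  "gibbs_pmf \<theta> = embed_pmf (\<lambda>i. if i < q then weight \<theta> i else 0)"

lemma pmf_gibbs: "pmf (gibbs_pmf \<theta>) i = (if i < q then weight \<theta> i else 0)"
  unfolding gibbs_pmf_def
proof (rule pmf_embed_pmf)
  show "0 \<le> (if i < q then weight \<theta> i else 0)" for i using weight_pos[of \<theta> i] by simp
  have "(\<integral>\<^sup>+i. ennreal (if i < q then weight \<theta> i else 0) \<partial>count_space UNIV)
      = (\<Sum>i<q. ennreal (if i < q then weight \<theta> i else 0))"
    by (rule nn_integral_count_space') auto
  also have "\<dots> = (\<Sum>i<q. ennreal (weight \<theta> i))" by (rule sum.cong) auto
  also have "\<dots> = 1" using weight_pos by (subst sum_ennreal) (auto simp: sum_weight less_imp_le)
  finally show "(\<integral>\<^sup>+i. ennreal (if i < q then weight \<theta> i else 0) \<partial>count_space UNIV) = 1" .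
qed

lemma set_pmf_gibbs: "set_pmf (gibbs_pmf \<theta>) = {..<q}"
  using weight_pos[of \<theta>] by (auto simp: set_pmf_iff pmf_gibbs less_le split: if_splits)

lemma expectation_gibbs: "measure_pmf.expectation (gibbs_pmf \<theta>) log_slope = mean_exponent \<theta>"
  by (subst integral_measure_pmf_real[of "{..<q}"])
    (auto simp: set_pmf_gibbs pmf_gibbs mean_exponent_def mult.commute intro!: sum.cong)

definition bernoulli_measure :: "real \<Rightarrow> (nat \<Rightarrow> nat) measure" where
  "bernoulli_measure \<theta> = PiM UNIV (\<lambda>_. measure_pmf (gibbs_pmf \<theta>))"

lemma prob_space_bernoulli: "prob_space (bernoulli_measure \<theta>)"
  unfolding bernoulli_measure_def by (intro prob_space_PiM prob_space_measure_pmf)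

lemma space_bernoulli: "space (bernoulli_measure \<theta>) = UNIV"
  by (simp add: bernoulli_measure_def space_PiM)

lemma measurable_digit: "(\<lambda>\<omega>. \<omega> k) \<in> measurable (bernoulli_measure \<theta>) (count_space UNIV)"
proof -
  have "(\<lambda>\<omega>. \<omega> k) \<in> measurable (bernoulli_measure \<theta>) (measure_pmf (gibbs_pmf \<theta>))"
    unfolding bernoulli_measure_def by simp
  then show ?thesis by simp
qed

definition cylinder :: "(nat \<Rightarrow> nat) \<Rightarrow> nat \<Rightarrow> (nat \<Rightarrow> nat) set" where
  "cylinder \<omega> n = {\<omega>'. \<forall>k<n. \<omega>' k = \<omega> k}"

lemma cylinder_conv_emb:
  "cylinder \<omega> n = prod_emb UNIV (\<lambda>_. measure_pmf (gibbs_pmf \<theta>)) {..<n} (PiE {..<n} (\<lambda>k. {\<omega> k}))"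
proof -
  have "restrict \<omega>' {..<n} \<in> PiE {..<n} (\<lambda>k. {\<omega> k}) \<longleftrightarrow> (\<forall>k<n. \<omega>' k = \<omega> k)" for \<omega>'
    by (simp only: PiE_iff restrict_extensional simp_thms singleton_iff Ball_def lessThan_iff)
      (simp cong: imp_cong)
  then show ?thesis by (simp add: cylinder_def prod_emb_def vimage_def)
qed

lemma sets_cylinder: "cylinder \<omega> n \<in> sets (bernoulli_measure \<theta>)"
  unfolding cylinder_conv_emb[of _ _ \<theta>] bernoulli_measure_def
  by (rule sets_PiM_I) auto

lemma emeasure_cylinder:
  assumes "\<And>k. \<omega> k < q"
  shows "emeasure (bernoulli_measure \<theta>) (cylinder \<omega> n) = ennreal (exp (\<theta> * birkhoff \<omega> n - n * pressure \<theta>))"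
proof -
  have "emeasure (bernoulli_measure \<theta>) (cylinder \<omega> n) = (\<Prod>k<n. emeasure (measure_pmf (gibbs_pmf \<theta>)) {\<omega> k})"
    unfolding cylinder_conv_emb[of _ _ \<theta>] bernoulli_measure_def
    by (subst emeasure_PiM_emb) (auto intro: prob_space_measure_pmf)
  also have "\<dots> = (\<Prod>k<n. ennreal (weight \<theta> (\<omega> k)))"
    using assms by (simp add: emeasure_pmf_single pmf_gibbs)
  also have "\<dots> = ennreal (\<Prod>k<n. weight \<theta> (\<omega> k))"
    using weight_pos by (intro prod_ennreal) (auto intro: less_imp_le)
  also have "(\<Prod>k<n. weight \<theta> (\<omega> k)) = exp (\<theta> * birkhoff \<omega> n - n * pressure \<theta>)"
    by (simp add: weight_eq_exp birkhoff_def sum_distrib_left sum_subtractf flip: exp_sum)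
  finally show ?thesis .
qed

definition typical :: "real \<Rightarrow> (nat \<Rightarrow> nat) \<Rightarrow> bool" where
  "typical \<theta> \<omega> \<longleftrightarrow> (\<forall>k. \<omega> k < q) \<and> (\<lambda>n. birkhoff \<omega> n / n) \<longlonglongrightarrow> mean_exponent \<theta>"

lemma AE_typical: "AE \<omega> in bernoulli_measure \<theta>. typical \<theta> \<omega>"
proof -
  have "AE \<omega> in bernoulli_measure \<theta>. \<forall>k. \<omega> k < q"
    unfolding bernoulli_measure_def AE_all_countable
    by (intro allI AE_PiM_component) (auto simp: AE_measure_pmf_iff set_pmf_gibbs intro: prob_space_measure_pmf)
  moreover have "log_slope i \<in> {0..1 + (\<Sum>i<q. log_slope i)}" if "i \<in> set_pmf (gibbs_pmf \<theta>)" for i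
    using that log_slope_pos member_le_sum[of i "{..<q}" log_slope] by (auto simp: set_pmf_gibbs less_imp_le)
  then have "AE \<omega> in bernoulli_measure \<theta>. (\<lambda>n. birkhoff \<omega> n / n) \<longlonglongrightarrow> mean_exponent \<theta>"
    unfolding bernoulli_measure_def birkhoff_def expectation_gibbs[symmetric]
    using log_slope_pos by (intro strong_law_bounded_pmf[where l = 0 and u = "1 + (\<Sum>i<q. log_slope i)"] add_pos_nonneg sum_nonneg)
      (auto intro: less_imp_le)
  ultimately show ?thesis unfolding typical_def by eventually_elim auto
qed

lemma typical_point: "typical \<theta> \<omega> \<Longrightarrow> point \<omega> \<in> level (mean_exponent \<theta>)"
  using point_code[of \<omega>] lyapunov_iff[of "point \<omega>"] by (auto simp: typical_def)

text \<open>By \<open>emeasure_cylinder\<close>, the inequality says that from generation \<open>N\<close> on, cylinders around \<open>\<omega>\<close> have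
  measure at most the \<open>s\<close>-th power of their length, which is the hypothesis of the mass distribution
  principle.\<close>

definition frostman_set :: "real \<Rightarrow> real \<Rightarrow> nat \<Rightarrow> (nat \<Rightarrow> nat) set" where
  "frostman_set \<theta> s N = {\<omega>. (\<forall>k. \<omega> k < q) \<and> (\<forall>n\<ge>N. (s + \<theta>) * birkhoff \<omega> n \<le> n * pressure \<theta>)}"

lemma sets_frostman: "frostman_set \<theta> s N \<in> sets (bernoulli_measure \<theta>)"
proof -
  note measurable_digit[measurable]
  have [measurable]: "(\<lambda>\<omega>. log_slope (\<omega> k)) \<in> borel_measurable (bernoulli_measure \<theta>)" for k
    by (rule measurable_compose[OF measurable_digit]) simp
  have "frostman_set \<theta> s N = {\<omega> \<in> space (bernoulli_measure \<theta>). (\<forall>k. \<omega> k < q) \<and>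
      (\<forall>n. N \<le> n \<longrightarrow> (s + \<theta>) * birkhoff \<omega> n \<le> n * pressure \<theta>)}"
    by (auto simp: frostman_set_def space_bernoulli)
  also have "\<dots> \<in> sets (bernoulli_measure \<theta>)"
    unfolding birkhoff_def by measurable
  finally show ?thesis .
qed

lemma typical_frostman:
  assumes "typical \<theta> \<omega>" "(s + \<theta>) * mean_exponent \<theta> < pressure \<theta>"
  shows "\<exists>N. \<omega> \<in> frostman_set \<theta> s N"
proof -
  have "(\<lambda>n. (s + \<theta>) * (birkhoff \<omega> n / n)) \<longlonglongrightarrow> (s + \<theta>) * mean_exponent \<theta>"
    using assms(1) by (intro tendsto_mult tendsto_const) (simp add: typical_def)
  then have "eventually (\<lambda>n. (s + \<theta>) * (birkhoff \<omega> n / n) < pressure \<theta>) sequentially"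
    using assms(2) by (rule order_tendstoD(2))
  then obtain N where N: "\<And>n. n \<ge> N \<Longrightarrow> (s + \<theta>) * (birkhoff \<omega> n / n) < pressure \<theta>"
    unfolding eventually_sequentially by blast
  have "(s + \<theta>) * birkhoff \<omega> n \<le> n * pressure \<theta>" if "n \<ge> max N 1" for n
    using N[of n] that by (simp add: field_simps)
  then show ?thesis
    using assms(1) by (intro exI[of _ "max N 1"]) (auto simp: frostman_set_def typical_def)
qed

lemma emeasure_cylinder_frostman:
  assumes "\<omega> \<in> frostman_set \<theta> s N" "n \<ge> N"
  shows "emeasure (bernoulli_measure \<theta>) (cylinder \<omega> n) \<le> ennreal (contraction \<omega> n powr s)"
proof -
  have \<omega>: "\<And>k. \<omega> k < q" and "(s + \<theta>) * birkhoff \<omega> n \<le> n * pressure \<theta>"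
    using assms by (auto simp: frostman_set_def)
  then have "exp (\<theta> * birkhoff \<omega> n - n * pressure \<theta>) \<le> exp (- s * birkhoff \<omega> n)"
    by (simp add: algebra_simps)
  also have "\<dots> = contraction \<omega> n powr s"
    using \<omega> by (simp add: contraction_eq_exp exp_powr_real mult.commute)
  finally show ?thesis using \<omega> by (simp add: emeasure_cylinder ennreal_leI)
qed

definition shortest :: real where "shortest = Min (r ` {..<q})"

lemma shortest_le: "i < q \<Longrightarrow> shortest \<le> r i"
  unfolding shortest_def by (intro Min_le) auto

lemma shortest_bounds: "0 < shortest" "shortest < 1"
proof -
  have ne: "{..<q} \<noteq> {}" using two_branches by (auto simp: lessThan_empty_iff)
  then have "shortest \<in> r ` {..<q}" unfolding shortest_def by (intro Min_in) auto
  then show "0 < shortest" "shortest < 1" using length_pos length_less_1 by auto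
qed

lemma contraction_ge:
  assumes "\<And>k. k < n \<Longrightarrow> \<omega> k < q" "n \<le> N"
  shows "shortest ^ N \<le> contraction \<omega> n"
proof -
  have "shortest ^ N \<le> shortest ^ n"
    using assms(2) shortest_bounds by (intro power_decreasing) auto
  also have "\<dots> = (\<Prod>k<n. shortest)" by simp
  also have "\<dots> \<le> contraction \<omega> n"
    unfolding contraction_def using assms(1) shortest_bounds shortest_le
    by (intro prod_mono) (auto intro: less_imp_le)
  finally show ?thesis .
qed

lemma frostman_singleton_null:
  assumes \<omega>: "\<omega> \<in> frostman_set \<theta> s N" and s: "s > 0"
  shows "{\<omega>} \<in> sets (bernoulli_measure \<theta>)" "emeasure (bernoulli_measure \<theta>) {\<omega>} = 0"
proof -
  have "{\<omega>} = (\<Inter>n. cylinder \<omega> n)" by (auto simp: cylinder_def)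
  then show "{\<omega>} \<in> sets (bernoulli_measure \<theta>)"
    using sets_cylinder by (auto intro!: sets.countable_INT)
  have digits: "\<And>k. \<omega> k < q" using \<omega> by (simp add: frostman_set_def)
  have "emeasure (bernoulli_measure \<theta>) {\<omega>} \<le> ennreal ((longest powr s) ^ n)" if "n \<ge> N" for n
  proof -
    have "emeasure (bernoulli_measure \<theta>) {\<omega>} \<le> emeasure (bernoulli_measure \<theta>) (cylinder \<omega> n)"
      by (intro emeasure_mono sets_cylinder) (auto simp: cylinder_def)
    also have "\<dots> \<le> ennreal (contraction \<omega> n powr s)" by (rule emeasure_cylinder_frostman[OF \<omega> that])
    also have "contraction \<omega> n powr s \<le> (longest ^ n) powr s"
      using s digits contraction_le[of n \<omega>] contraction_pos[of n \<omega>] by (intro powr_mono2) (auto intro: less_imp_le)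
    also have "\<dots> = (longest powr s) ^ n"
      using longest_bounds by (simp add: powr_realpow [symmetric] powr_powr mult.commute)
    finally show ?thesis by (simp add: ennreal_leI)
  qed
  moreover have "(\<lambda>n. ennreal ((longest powr s) ^ n)) \<longlonglongrightarrow> ennreal 0"
    using s longest_bounds by (intro tendsto_ennrealI LIMSEQ_power_zero) (use powr_less_mono2[of s longest 1] in simp)
  ultimately have "emeasure (bernoulli_measure \<theta>) {\<omega>} \<le> ennreal 0"
    by (intro LIMSEQ_le_const) auto
  then show "emeasure (bernoulli_measure \<theta>) {\<omega>} = 0" by simp
qed

text \<open>The mass distribution principle. Sequences in the Frostman set whose points lie in \<open>U\<close> share a longest
  common prefix, and the points of two sequences that separate after it are at distance at least \<open>gap\<close> times the
  length of the cylinder of the prefix. So the cylinder is not much longer than \<open>U\<close>, and its measure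
  is controlled by its length. The bound on \<open>\<delta>\<close> forces the prefix to be at least \<open>N\<close> digits long. If
  there is only one such sequence, no prefix is longest, but for \<open>s > 0\<close> a single Frostman sequence is null;
  for \<open>s = 0\<close> every nonempty \<open>U\<close> counts as \<open>1\<close>, the total mass.\<close>

lemma frostman_bound:
  fixes U :: "real set"
  assumes s: "s \<ge> 0" and U: "bounded U" "diameter U \<le> \<delta>" and \<delta>: "\<delta> < gap * shortest ^ N"
  shows "\<exists>C \<in> sets (bernoulli_measure \<theta>). {\<omega> \<in> frostman_set \<theta> s N. point \<omega> \<in> U} \<subseteq> C \<and>
           emeasure (bernoulli_measure \<theta>) C \<le> ennreal (gap powr (- s)) * diam_pow s U"
proof -
  let ?\<mu> = "bernoulli_measure \<theta>"
  define H where "H = {\<omega> \<in> frostman_set \<theta> s N. point \<omega> \<in> U}"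
  have digits: "\<omega> k < q" if "\<omega> \<in> H" for \<omega> k using that by (simp add: H_def frostman_set_def)
  consider "H = {}" | "H \<noteq> {}" "s = 0" | \<omega> where "s > 0" "H = {\<omega>}"
    | \<omega> \<omega>' where "s > 0" "\<omega> \<in> H" "\<omega>' \<in> H" "\<omega> \<noteq> \<omega>'"
    using s by (metis is_singletonI' is_singleton_def order_le_less)
  then have "\<exists>C \<in> sets ?\<mu>. H \<subseteq> C \<and> emeasure ?\<mu> C \<le> ennreal (gap powr (- s)) * diam_pow s U"
  proof cases
    case 1
    then show ?thesis by (intro bexI[of _ "{}"]) auto
  next
    case 2
    then have "U \<noteq> {}" by (auto simp: H_def)
    moreover have "UNIV \<in> sets ?\<mu>" using sets.top[of ?\<mu>] by (simp add: space_bernoulli)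
    ultimately show ?thesis using 2 prob_space.emeasure_space_1[OF prob_space_bernoulli[of \<theta>]] gap_pos
      by (intro bexI[of _ "space ?\<mu>"]) (auto simp: space_bernoulli diam_pow_def)
  next
    case 3
    then have "\<omega> \<in> frostman_set \<theta> s N" by (auto simp: H_def)
    from frostman_singleton_null[OF this 3(1)] 3 show ?thesis by (intro bexI[of _ "{\<omega>}"]) auto
  next
    case 4
    define n where "n = (LEAST n. \<exists>\<omega>\<in>H. \<exists>\<omega>'\<in>H. \<omega> n \<noteq> \<omega>' n)"
    have "\<exists>n. \<exists>\<omega>\<in>H. \<exists>\<omega>'\<in>H. \<omega> n \<noteq> \<omega>' n" using 4 by blast
    then have "\<exists>\<omega>\<in>H. \<exists>\<omega>'\<in>H. \<omega> n \<noteq> \<omega>' n" unfolding n_def by (rule LeastI_ex)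
    then obtain \<xi> \<xi>' where \<xi>: "\<xi> \<in> H" "\<xi>' \<in> H" "\<xi> n \<noteq> \<xi>' n" by blast
    have agree: "\<eta> k = \<eta>' k" if "\<eta> \<in> H" "\<eta>' \<in> H" "k < n" for \<eta> \<eta>' k
      using not_less_Least[OF that(3)[unfolded n_def]] that(1,2) by blast
    have codes: "point \<eta> \<in> inv_set" "code (point \<eta>) = \<eta>" if "\<eta> \<in> H" for \<eta>
      using point_code[of \<eta>] digits[OF that] by auto
    have "gap * contraction \<xi> n \<le> \<bar>point \<xi> - point \<xi>'\<bar>"
      using cylinder_separation[of "point \<xi>" "point \<xi>'" n] codes \<xi> agree by simp
    also have "\<dots> \<le> diameter U"
      using diameter_bounded_bound[OF U(1), of "point \<xi>" "point \<xi>'"] \<xi> by (simp add: H_def dist_real_def)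
    finally have diam: "gap * contraction \<xi> n \<le> diameter U" .
    have "n \<ge> N"
    proof (rule ccontr)
      assume "\<not> n \<ge> N"
      then have "gap * shortest ^ N \<le> gap * contraction \<xi> n"
        using gap_pos digits[OF \<xi>(1)] by (intro mult_left_mono contraction_ge) auto
      with diam U(2) \<delta> show False by linarith
    qed
    then have "emeasure ?\<mu> (cylinder \<xi> n) \<le> ennreal (contraction \<xi> n powr s)"
      using \<xi>(1) by (intro emeasure_cylinder_frostman) (auto simp: H_def)
    also have "contraction \<xi> n powr s \<le> (diameter U / gap) powr s"
      using diam gap_pos contraction_pos[of n \<xi>] digits[OF \<xi>(1)] s
      by (intro powr_mono2) (auto simp: field_simps intro: less_imp_le)
    also have "\<dots> = gap powr (- s) * diameter U powr s"
      using gap_pos diameter_ge_0[OF U(1)] by (simp add: powr_divide powr_minus_divide)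
    finally have "emeasure ?\<mu> (cylinder \<xi> n) \<le> ennreal (gap powr (- s)) * diam_pow s U"
      using \<xi>(1) 4(1) by (auto simp: H_def diam_pow_def ennreal_leI simp flip: ennreal_mult)
    moreover have "H \<subseteq> cylinder \<xi> n" using agree \<xi>(1) by (auto simp: cylinder_def)
    ultimately show ?thesis using sets_cylinder by blast
  qed
  then show ?thesis by (simp add: H_def)
qed

text \<open>A cover of the level set of small total size would cover almost all of the Frostman set by
  cylinders of small total measure, because almost every sequence codes a point of the level set.\<close>

lemma frostman_set_null:
  assumes s: "s \<ge> 0" and zero: "hausdorff_measure s (level (mean_exponent \<theta>)) = 0"
  shows "emeasure (bernoulli_measure \<theta>) (frostman_set \<theta> s N) = 0"
proof -
  let ?\<mu> = "bernoulli_measure \<theta>" and ?c = "ennreal (gap powr (- s))"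
  define \<delta> where "\<delta> = gap * shortest ^ N / 2"
  have \<delta>: "0 < \<delta>" "\<delta> < gap * shortest ^ N" using gap_pos shortest_bounds by (auto simp: \<delta>_def)
  have "hausdorff_premeasure s \<delta> (level (mean_exponent \<theta>)) \<le> hausdorff_measure s (level (mean_exponent \<theta>))"
    unfolding hausdorff_measure_def using \<delta> by (intro SUP_upper) auto
  then have pre: "hausdorff_premeasure s \<delta> (level (mean_exponent \<theta>)) = 0" using zero by simp
  have "emeasure ?\<mu> (frostman_set \<theta> s N) \<le> ?c * e" if "e > 0" for e :: ennreal
  proof -
    have "hausdorff_premeasure s \<delta> (level (mean_exponent \<theta>)) < e" using pre that by simp
    then obtain U :: "nat \<Rightarrow> real set" where U: "level (mean_exponent \<theta>) \<subseteq> (\<Union>i. U i)"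
      "\<And>i. bounded (U i) \<and> diameter (U i) \<le> \<delta>" "(\<Sum>i. diam_pow s (U i)) < e"
      unfolding hausdorff_premeasure_def INF_less_iff by auto
    have "\<forall>i. \<exists>C \<in> sets ?\<mu>. {\<omega> \<in> frostman_set \<theta> s N. point \<omega> \<in> U i} \<subseteq> C \<and>
           emeasure ?\<mu> C \<le> ?c * diam_pow s (U i)"
      using frostman_bound[OF s _ _ \<delta>(2)] U(2) by blast
    from choice[OF this[unfolded Bex_def]] obtain C where "\<forall>i. C i \<in> sets ?\<mu> \<and> {\<omega> \<in> frostman_set \<theta> s N. point \<omega> \<in> U i} \<subseteq> C i \<and>
           emeasure ?\<mu> (C i) \<le> ?c * diam_pow s (U i)" ..
    then have C: "C i \<in> sets ?\<mu>" "{\<omega> \<in> frostman_set \<theta> s N. point \<omega> \<in> U i} \<subseteq> C i"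
      "emeasure ?\<mu> (C i) \<le> ?c * diam_pow s (U i)" for i by auto
    have "AE \<omega> in ?\<mu>. \<omega> \<in> frostman_set \<theta> s N \<longrightarrow> \<omega> \<in> (\<Union>i. C i)"
      using AE_typical[of \<theta>]
    proof eventually_elim
      case (elim \<omega>)
      then obtain i where "point \<omega> \<in> U i" using typical_point U(1) by blast
      then show ?case using C(2)[of i] by blast
    qed
    then have "emeasure ?\<mu> (frostman_set \<theta> s N) \<le> emeasure ?\<mu> (\<Union>i. C i)"
      using C(1) by (intro emeasure_mono_AE) auto
    also have "\<dots> \<le> (\<Sum>i. emeasure ?\<mu> (C i))"
      using C(1) by (intro emeasure_subadditive_countably) auto
    also have "\<dots> \<le> (\<Sum>i. ?c * diam_pow s (U i))" using C(3) by (intro suminf_le) auto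
    also have "\<dots> = ?c * (\<Sum>i. diam_pow s (U i))" by simp
    also have "\<dots> \<le> ?c * e" using U(3) by (intro mult_left_mono) auto
    finally show ?thesis .
  qed
  then have "emeasure ?\<mu> (frostman_set \<theta> s N) \<le> ?c * ennreal (1 / Suc m)" for m by simp
  moreover have "(\<lambda>m. ?c * ennreal (1 / Suc m)) \<longlonglongrightarrow> ennreal (gap powr (- s) * 0)"
    unfolding ennreal_mult'[OF powr_ge_zero, symmetric]
    by (intro tendsto_ennrealI tendsto_mult tendsto_const LIMSEQ_Suc[OF lim_1_over_n])
  ultimately have "emeasure ?\<mu> (frostman_set \<theta> s N) \<le> ennreal (gap powr (- s) * 0)"
    by (intro LIMSEQ_le_const) auto
  then show ?thesis by simp
qed

text \<open>Almost every sequence lies in a Frostman set, so these cannot all be null.\<close>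

proposition hausdorff_measure_level_neq_0:
  assumes s: "s \<ge> 0" and less: "(s + \<theta>) * mean_exponent \<theta> < pressure \<theta>"
  shows "hausdorff_measure s (level (mean_exponent \<theta>)) \<noteq> 0"
proof
  let ?\<mu> = "bernoulli_measure \<theta>"
  interpret prob_space ?\<mu> by (rule prob_space_bernoulli)
  assume "hausdorff_measure s (level (mean_exponent \<theta>)) = 0"
  then have "AE \<omega> in ?\<mu>. \<omega> \<notin> frostman_set \<theta> s N" for N
    using frostman_set_null[OF s] sets_frostman by (intro AE_not_in null_setsI) auto
  then have "AE \<omega> in ?\<mu>. \<forall>N. \<omega> \<notin> frostman_set \<theta> s N" by (simp add: AE_all_countable)
  with AE_typical[of \<theta>] have "AE \<omega> in ?\<mu>. False"
    by eventually_elim (use typical_frostman[OF _ less] in blast)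
  then show False by simp
qed

lemma level_nonempty: "level (mean_exponent \<theta>) \<noteq> {}"
proof -
  interpret prob_space "bernoulli_measure \<theta>" by (rule prob_space_bernoulli)
  have "\<exists>\<omega>. typical \<theta> \<omega>"
  proof (rule ccontr)
    assume "\<nexists>\<omega>. typical \<theta> \<omega>"
    then have "AE \<omega> in bernoulli_measure \<theta>. False" using AE_typical[of \<theta>] by simp
    then show False by simp
  qed
  then show ?thesis using typical_point by blast
qed

text \<open>Both criteria compare \<open>s\<close> with the same number, since the exponent \<open>mean_exponent \<theta>\<close> is the one for
  which \<open>\<theta>\<close> is optimal. The number is nonnegative because \<open>pressure \<theta> - \<theta> * mean_exponent \<theta>\<close> is the entropy
  of the weights; so the passage through extended reals loses nothing.\<close>

theorem lyapunov_spectrum_mean_exponent: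
  "lyapunov_spectrum D T (mean_exponent \<theta>) = pressure \<theta> / mean_exponent \<theta> - \<theta>"
proof -
  let ?A = "mean_exponent \<theta>" and ?E = "level (mean_exponent \<theta>)"
  define d where "d = pressure \<theta> / mean_exponent \<theta> - \<theta>"
  note A = mean_exponent_pos[of \<theta>]
  have cmp: "pressure \<theta> < (s + \<theta>) * ?A \<longleftrightarrow> d < s" "(s + \<theta>) * ?A < pressure \<theta> \<longleftrightarrow> s < d" for s
    using A by (auto simp: d_def field_simps)
  have "0 \<le> (\<Sum>i<q. weight \<theta> i * (pressure \<theta> - \<theta> * log_slope i))"
  proof (intro sum_nonneg mult_nonneg_nonneg)
    fix i assume "i \<in> {..<q}"
    then have "weight \<theta> i \<le> 1"
      using member_le_sum[of i "{..<q}" "weight \<theta>"] weight_pos by (simp add: sum_weight less_imp_le)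
    then show "0 \<le> pressure \<theta> - \<theta> * log_slope i" by (simp add: weight_eq_exp)
  qed (use weight_pos in \<open>auto intro: less_imp_le\<close>)
  also have "\<dots> = (\<Sum>i<q. weight \<theta> i * pressure \<theta> - \<theta> * (weight \<theta> i * log_slope i))"
    by (simp add: algebra_simps)
  also have "\<dots> = (\<Sum>i<q. weight \<theta> i) * pressure \<theta> - \<theta> * ?A"
    by (simp only: mean_exponent_def sum_subtractf sum_distrib_left sum_distrib_right)
  also have "\<dots> = pressure \<theta> - \<theta> * ?A" by (simp add: sum_weight)
  finally have d0: "d \<ge> 0" using A by (simp add: d_def field_simps)
  have "hausdorff_dim ?E = ennreal d"
  proof (rule antisym)
    show "hausdorff_dim ?E \<le> ennreal d"
    proof (rule ennreal_le_epsilon)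
      fix e :: real assume "e > 0"
      then have "hausdorff_measure (d + e) ?E = 0"
        using d0 cmp by (intro hausdorff_measure_level_eq_0[of _ \<theta>]) auto
      then have "hausdorff_dim ?E \<le> ennreal (d + e)"
        unfolding hausdorff_dim_def using d0 \<open>e > 0\<close> by (intro INF_lower) auto
      then show "hausdorff_dim ?E \<le> ennreal d + ennreal e" using d0 \<open>e > 0\<close> by (simp add: ennreal_plus)
    qed
    show "ennreal d \<le> hausdorff_dim ?E"
      unfolding hausdorff_dim_def
    proof (rule INF_greatest)
      fix s assume "s \<in> {s. 0 \<le> s \<and> hausdorff_measure s ?E = 0}"
      then have "\<not> s < d" using hausdorff_measure_level_neq_0 cmp by auto
      then show "ennreal d \<le> ennreal s" by (simp add: ennreal_leI)
    qed
  qed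
  then show ?thesis using d0 by (simp add: lyapunov_spectrum_def d_def)
qed

section \<open>Derivatives of the spectrum\<close>

definition variance :: "real \<Rightarrow> real" where
  "variance \<theta> = (\<Sum>i<q. weight \<theta> i * (log_slope i - mean_exponent \<theta>)\<^sup>2)"

lemma variance_eq: "variance \<theta> = (\<Sum>i<q. weight \<theta> i * (log_slope i)\<^sup>2) - (mean_exponent \<theta>)\<^sup>2"
proof -
  let ?A = "mean_exponent \<theta>"
  have "variance \<theta> = (\<Sum>i<q. weight \<theta> i * (log_slope i)\<^sup>2 - 2 * ?A * (weight \<theta> i * log_slope i) + ?A\<^sup>2 * weight \<theta> i)"
    unfolding variance_def by (intro sum.cong) (auto simp: power2_eq_square algebra_simps)
  also have "\<dots> = (\<Sum>i<q. weight \<theta> i * (log_slope i)\<^sup>2) - 2 * ?A * ?A + ?A\<^sup>2 * 1"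
    by (simp only: sum.distrib sum_subtractf sum_distrib_left [symmetric] sum_weight mean_exponent_def [symmetric])
  finally show ?thesis by (simp add: power2_eq_square)
qed

lemma has_derivative_partition_sum:
  "(partition_sum has_real_derivative partition_sum \<theta> * mean_exponent \<theta>) (at \<theta>)"
proof -
  have "partition_sum \<theta> * mean_exponent \<theta> = (\<Sum>i<q. exp (\<theta> * log_slope i) * log_slope i)"
    using partition_sum_pos[of \<theta>] by (simp add: mean_exponent_def weight_def sum_distrib_left)
  then show ?thesis
    unfolding partition_sum_def[abs_def] by (auto intro!: derivative_eq_intros sum.cong)
qed

lemma has_derivative_pressure: "(pressure has_real_derivative mean_exponent \<theta>) (at \<theta>)"
proof -
  have "((\<lambda>\<theta>. ln (partition_sum \<theta>)) has_real_derivative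
          (partition_sum \<theta> * mean_exponent \<theta>) / partition_sum \<theta>) (at \<theta>)"
    using partition_sum_pos[of \<theta>]
    by (auto intro!: derivative_eq_intros has_derivative_partition_sum)
  then show ?thesis using partition_sum_pos[of \<theta>] by (simp add: pressure_def[abs_def])
qed

lemma has_derivative_weight:
  "((\<lambda>\<theta>. weight \<theta> i) has_real_derivative weight \<theta> i * (log_slope i - mean_exponent \<theta>)) (at \<theta>)"
  unfolding weight_eq_exp by (auto intro!: derivative_eq_intros has_derivative_pressure)

lemma has_derivative_mean_exponent: "(mean_exponent has_real_derivative variance \<theta>) (at \<theta>)"
proof -
  have "((\<lambda>\<theta>. \<Sum>i<q. weight \<theta> i * log_slope i) has_real_derivative
          (\<Sum>i<q. weight \<theta> i * (log_slope i - mean_exponent \<theta>) * log_slope i)) (at \<theta>)"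
    by (auto intro!: derivative_eq_intros has_derivative_weight)
  moreover have "(\<Sum>i<q. weight \<theta> i * (log_slope i - mean_exponent \<theta>) * log_slope i)
      = (\<Sum>i<q. weight \<theta> i * (log_slope i)\<^sup>2 - mean_exponent \<theta> * (weight \<theta> i * log_slope i))"
    by (intro sum.cong) (auto simp: power2_eq_square algebra_simps)
  then have "(\<Sum>i<q. weight \<theta> i * (log_slope i - mean_exponent \<theta>) * log_slope i) = variance \<theta>"
    by (simp only: sum_subtractf sum_distrib_left [symmetric] mean_exponent_def [symmetric]
        variance_eq power2_eq_square)
  ultimately show ?thesis by (simp add: mean_exponent_def[abs_def])
qed

lemma lyapunov_values_bounded: "lyapunov_values D T \<subseteq> {0..(\<Sum>i<q. log_slope i)}"
proof
  fix \<alpha> assume "\<alpha> \<in> lyapunov_values D T"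
  then obtain x where x: "x \<in> inv_set" and lim: "(\<lambda>n. birkhoff (code x) n / n) \<longlonglongrightarrow> \<alpha>"
    using lyapunov_iff by (auto simp: lyapunov_values_def)
  have bounds: "0 \<le> log_slope (code x k)" "log_slope (code x k) \<le> (\<Sum>i<q. log_slope i)" for k
    using log_slope_pos code_less[OF x, of k] member_le_sum[of "code x k" "{..<q}" log_slope] by (auto simp: less_imp_le)
  have "birkhoff (code x) n \<le> n * (\<Sum>i<q. log_slope i)" for n
    using sum_mono[of "{..<n}" "\<lambda>k. log_slope (code x k)" "\<lambda>_. \<Sum>i<q. log_slope i"] bounds by (simp add: birkhoff_def)
  then have "birkhoff (code x) n / n \<le> (\<Sum>i<q. log_slope i)" if "n \<ge> 1" for n
    using that by (simp add: divide_le_eq mult.commute)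
  then have "\<alpha> \<le> (\<Sum>i<q. log_slope i)" by (intro LIMSEQ_le_const2[OF lim]) blast
  moreover have "0 \<le> \<alpha>"
    using bounds by (intro LIMSEQ_le_const[OF lim]) (auto simp: birkhoff_def sum_nonneg)
  ultimately show "\<alpha> \<in> {0..(\<Sum>i<q. log_slope i)}" by simp
qed

lemma mean_exponent_in_values: "mean_exponent \<theta> \<in> lyapunov_values D T"
  using level_nonempty[of \<theta>] by (auto simp: lyapunov_values_def)

end

text \<open>With equal lengths there is only one exponent. Otherwise the pressure is strictly convex and its
  derivative is an open embedding of the line.\<close>

locale nonuniform_branch_lengths = branch_lengths +
  assumes nonuniform: "\<exists>i<q. \<exists>j<q. r i \<noteq> r j"
begin

lemma variance_pos: "0 < variance \<theta>"
proof -
  obtain i j where ij: "i < q" "j < q" "r i \<noteq> r j" using nonuniform by blast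
  then have "log_slope i \<noteq> log_slope j" using length_pos by (simp add: log_slope_def)
  then obtain k where "k < q" "log_slope k \<noteq> mean_exponent \<theta>" using ij by metis
  then show ?thesis unfolding variance_def
    using weight_pos[of \<theta>] by (intro sum_pos2[of _ k]) (auto intro!: mult_nonneg_nonneg intro: less_imp_le)
qed

lemma strict_mono_mean_exponent: "strict_mono mean_exponent"
  using DERIV_pos_imp_increasing[of _ _ mean_exponent] has_derivative_mean_exponent variance_pos
  by (intro strict_monoI) blast

lemma isCont_mean_exponent: "isCont mean_exponent \<theta>"
  using has_derivative_mean_exponent by (rule DERIV_isCont)

text \<open>The parameter \<open>\<theta>\<close> as a function of the exponent.\<close>

definition tilt :: "real \<Rightarrow> real" where "tilt = inv mean_exponent"

lemma tilt_mean_exponent: "tilt (mean_exponent \<theta>) = \<theta>"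
  unfolding tilt_def using strict_mono_mean_exponent by (simp add: strict_mono_imp_inj_on)

lemma mean_exponent_between:
  assumes "y \<in> {mean_exponent c <..< mean_exponent d}"
  shows "y \<in> range mean_exponent"
proof -
  have "c \<le> d"
    using assms strict_mono_less_eq[OF strict_mono_mean_exponent, of c d] by auto
  then show ?thesis
    using IVT[of mean_exponent c y d] assms isCont_mean_exponent by fastforce
qed

lemma mean_exponent_tilt: "y \<in> range mean_exponent \<Longrightarrow> mean_exponent (tilt y) = y"
  using tilt_mean_exponent by auto

lemma open_range_mean_exponent: "open (range mean_exponent)"
proof (subst open_subopen, intro ballI)
  fix y assume "y \<in> range mean_exponent"
  then obtain \<theta> where \<theta>: "y = mean_exponent \<theta>" by auto
  show "\<exists>S. open S \<and> y \<in> S \<and> S \<subseteq> range mean_exponent"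
    using mean_exponent_between strict_monoD[OF strict_mono_mean_exponent]
    by (intro exI[of _ "{mean_exponent (\<theta> - 1) <..< mean_exponent (\<theta> + 1)}"]) (auto simp: \<theta>)
qed

lemma has_derivative_tilt:
  "(tilt has_real_derivative 1 / variance \<theta>) (at (mean_exponent \<theta>))"
proof -
  have "isCont tilt (mean_exponent \<theta>)"
    by (rule isCont_inverse_function2[of "\<theta> - 1" _ "\<theta> + 1"])
      (auto simp: tilt_mean_exponent isCont_mean_exponent)
  moreover have "(mean_exponent has_real_derivative variance \<theta>) (at (tilt (mean_exponent \<theta>)))"
    by (simp add: tilt_mean_exponent has_derivative_mean_exponent)
  ultimately have "(tilt has_real_derivative inverse (variance \<theta>)) (at (mean_exponent \<theta>))"
    using variance_pos[of \<theta>] strict_monoD[OF strict_mono_mean_exponent]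
      mean_exponent_tilt mean_exponent_between
    by (intro DERIV_inverse_function[where f = mean_exponent and a = "mean_exponent (\<theta> - 1)" and b = "mean_exponent (\<theta> + 1)"]) auto
  then show ?thesis by (simp add: inverse_eq_divide)
qed

text \<open>The two terms containing the derivative of \<open>tilt\<close> cancel, as always for a Legendre transform.\<close>

lemma has_derivative_spectrum:
  assumes "y \<in> range mean_exponent"
  shows "(lyapunov_spectrum D T has_real_derivative - pressure (tilt y) / y\<^sup>2) (at y)"
proof -
  obtain \<theta> where \<theta>: "y = mean_exponent \<theta>" using assms by auto
  have "((\<lambda>y. pressure (tilt y) / y - tilt y) has_real_derivative
      (mean_exponent \<theta> * (1 / variance \<theta>) * y - pressure \<theta>) / (y * y) - 1 / variance \<theta>) (at y)"
    using mean_exponent_pos[of \<theta>]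
    by (auto simp: \<theta> tilt_mean_exponent
        intro!: derivative_eq_intros has_derivative_tilt has_derivative_tilt[THEN DERIV_chain2[rotated]] has_derivative_pressure)
  moreover have "(mean_exponent \<theta> * (1 / variance \<theta>) * y - pressure \<theta>) / (y * y) - 1 / variance \<theta>
      = - pressure (tilt y) / y\<^sup>2"
    using variance_pos[of \<theta>] mean_exponent_pos[of \<theta>]
    by (simp add: \<theta> tilt_mean_exponent divide_simps power2_eq_square)
  ultimately have "((\<lambda>y. pressure (tilt y) / y - tilt y) has_real_derivative - pressure (tilt y) / y\<^sup>2) (at y)"
    by simp
  then show ?thesis
    using open_range_mean_exponent assms
    by (rule has_field_derivative_transform_within_open)
      (auto simp: lyapunov_spectrum_mean_exponent tilt_mean_exponent)
qed

text \<open>Differentiating the formula of \<open>has_derivative_spectrum\<close> once more at \<open>A = mean_exponent \<theta>\<close>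
  gives \<open>(2 P V - A\<^sup>2) / (A\<^sup>3 V)\<close>, with \<open>P\<close> the pressure and \<open>V\<close> the variance at \<open>\<theta>\<close>.\<close>

theorem inflection_point_mean_exponent:
  assumes "2 * pressure \<theta> * variance \<theta> = (mean_exponent \<theta>)\<^sup>2"
  shows "mean_exponent \<theta> \<in> inflection_points D T"
proof -
  let ?A = "mean_exponent \<theta>"
  have bdd: "bdd_below (lyapunov_values D T)" "bdd_above (lyapunov_values D T)"
    using lyapunov_values_bounded by (auto intro: bdd_below_mono bdd_above_mono)
  have "Inf (lyapunov_values D T) \<le> mean_exponent (\<theta> - 1)"
    using bdd mean_exponent_in_values by (intro cInf_lower)
  then have low: "Inf (lyapunov_values D T) < ?A"
    using strict_monoD[OF strict_mono_mean_exponent, of "\<theta> - 1" \<theta>] by simp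
  have "mean_exponent (\<theta> + 1) \<le> Sup (lyapunov_values D T)"
    using bdd mean_exponent_in_values by (intro cSup_upper)
  then have up: "?A < Sup (lyapunov_values D T)"
    using strict_monoD[OF strict_mono_mean_exponent, of \<theta> "\<theta> + 1"] by simp
  have "eventually (\<lambda>y. y \<in> range mean_exponent) (nhds ?A)"
    using open_range_mean_exponent by (intro eventually_nhds_in_open) auto
  then have diff: "eventually (\<lambda>y. lyapunov_spectrum D T field_differentiable at y) (nhds ?A)"
    by (rule eventually_mono) (use has_derivative_spectrum in \<open>auto simp: field_differentiable_def\<close>)
  have "((\<lambda>y. - pressure (tilt y) / y\<^sup>2) has_real_derivative
      (- (?A * (1 / variance \<theta>)) * ?A\<^sup>2 + pressure \<theta> * (2 * ?A)) / (?A\<^sup>2 * ?A\<^sup>2)) (at ?A)"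
    using mean_exponent_pos[of \<theta>]
    by (auto simp: tilt_mean_exponent diff_divide_distrib
        intro!: derivative_eq_intros has_derivative_tilt[THEN DERIV_chain2[rotated]] has_derivative_pressure)
  moreover have "- (?A * (1 / variance \<theta>)) * ?A\<^sup>2 + pressure \<theta> * (2 * ?A) = 0"
    using variance_pos[of \<theta>] by (simp add: assms [symmetric])
  ultimately have "((\<lambda>y. - pressure (tilt y) / y\<^sup>2) has_real_derivative 0) (at ?A)" by simp
  then have "(deriv (lyapunov_spectrum D T) has_real_derivative 0) (at ?A)"
    by (rule has_field_derivative_transform_within_open[OF _ open_range_mean_exponent])
      (use has_derivative_spectrum in \<open>auto intro: DERIV_imp_deriv[symmetric]\<close>)
  with low up diff show ?thesis unfolding inflection_points_def by blast
qed

text \<open>Each sign change yields a zero between consecutive nodes, and the strictly increasing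
  \<open>mean_exponent\<close> keeps the corresponding exponents distinct.\<close>

theorem many_inflection_points:
  fixes t :: "nat \<Rightarrow> real"
  assumes t: "strict_mono t"
    and sign: "\<And>k. k \<le> n \<Longrightarrow> 0 < (-1) ^ k * ((mean_exponent (t k))\<^sup>2 - 2 * pressure (t k) * variance (t k))"
  shows "\<exists>S. S \<subseteq> inflection_points D T \<and> finite S \<and> card S \<ge> n"
proof -
  define F where "F \<theta> = (mean_exponent \<theta>)\<^sup>2 - 2 * pressure \<theta> * variance \<theta>" for \<theta>
  have cont: "isCont F \<theta>" for \<theta>
    unfolding F_def variance_def weight_def partition_sum_def
    using DERIV_isCont[OF has_derivative_pressure] isCont_mean_exponent partition_sum_pos[of \<theta>]
    by (intro continuous_intros) (auto simp: partition_sum_def)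
  have "\<exists>z. t k < z \<and> z < t (Suc k) \<and> F z = 0" if "k < n" for k
  proof -
    have "(-1) ^ k = (1::real) \<or> (-1) ^ k = (-1::real)" using neg_one_even_power neg_one_odd_power by blast
    then have signs: "F (t k) < 0 \<and> 0 < F (t (Suc k)) \<or> 0 < F (t k) \<and> F (t (Suc k)) < 0"
      using sign[of k] sign[of "Suc k"] that unfolding F_def by auto
    have le: "t k \<le> t (Suc k)" using t by (simp add: strict_mono_def less_imp_le)
    have "\<exists>z. t k \<le> z \<and> z \<le> t (Suc k) \<and> F z = 0"
      using signs IVT[of F "t k" 0 "t (Suc k)"] IVT2[of F "t (Suc k)" 0 "t k"] le cont by auto
    then show ?thesis using signs by (metis less_irrefl order_le_less)
  qed
  then obtain z where z: "\<And>k. k < n \<Longrightarrow> t k < z k \<and> z k < t (Suc k) \<and> F (z k) = 0" by metis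
  have less: "z k < z l" if "k < l" "l < n" for k l
  proof -
    have "z k < t (Suc k)" using z that by simp
    also have "t (Suc k) \<le> t l" using t that by (simp add: strict_mono_less_eq)
    also have "t l < z l" using z that by simp
    finally show ?thesis .
  qed
  have "inj_on z {..<n}"
    by (rule linorder_inj_onI) (use less in \<open>force+\<close>)
  then have "inj_on (mean_exponent \<circ> z) {..<n}"
    using strict_mono_mean_exponent by (intro comp_inj_on) (auto intro: strict_mono_imp_inj_on inj_on_subset)
  then have "card ((mean_exponent \<circ> z) ` {..<n}) = n" by (subst card_image) auto
  moreover have "(mean_exponent \<circ> z) ` {..<n} \<subseteq> inflection_points D T"
    using z by (auto simp: F_def intro!: inflection_point_mean_exponent)
  ultimately show ?thesis by (intro exI[of _ "(mean_exponent \<circ> z) ` {..<n}"]) auto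
qed

end

section \<open>Branch lengths whose pressure is close to a polygon\<close>

lemma sum_square_deviation_ge:
  fixes p y :: "'a \<Rightarrow> real"
  assumes "sum p I = 1"
  shows "(\<Sum>j\<in>I. p j * (y j - (\<Sum>j\<in>I. p j * y j))\<^sup>2) \<le> (\<Sum>j\<in>I. p j * (y j - c)\<^sup>2)"
proof -
  define \<mu> where "\<mu> = (\<Sum>j\<in>I. p j * y j)"
  have "(\<Sum>j\<in>I. p j * (y j - c)\<^sup>2)
      = (\<Sum>j\<in>I. p j * (y j - \<mu>)\<^sup>2 + 2 * (\<mu> - c) * (p j * y j) + (c\<^sup>2 - \<mu>\<^sup>2) * p j)"
    by (intro sum.cong) (auto simp: power2_eq_square algebra_simps)
  also have "\<dots> = (\<Sum>j\<in>I. p j * (y j - \<mu>)\<^sup>2) + 2 * (\<mu> - c) * \<mu> + (c\<^sup>2 - \<mu>\<^sup>2) * 1"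
    by (simp only: sum.distrib sum_distrib_left [symmetric] assms \<mu>_def [symmetric])
  also have "\<dots> = (\<Sum>j\<in>I. p j * (y j - \<mu>)\<^sup>2) + (\<mu> - c)\<^sup>2"
    by (simp add: power2_eq_square algebra_simps)
  finally show ?thesis by (simp add: \<mu>_def)
qed

text \<open>Branch lengths come in \<open>K + 1\<close> grades; \<open>sum_grade\<close> says that grade \<open>j\<close> occurs \<open>exp (x (K\<^sup>2 - j\<^sup>2))\<close> times. The
  summand \<open>K\<^sup>2 + 1\<close> in the exponent of the
  length offsets the multiplicity, so that every grade has total length at most \<open>exp (- x)\<close>.\<close>

locale theta_branch_lengths = branch_lengths +
  fixes K :: nat and x :: real and grade :: "nat \<Rightarrow> nat"
  assumes x: "x > 0"
    and length_eq: "\<And>i. i < q \<Longrightarrow> r i = exp (- (x * ((real K)\<^sup>2 + 1 + grade i)))"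
    and sum_grade: "\<And>f :: nat \<Rightarrow> real. (\<Sum>i<q. f (grade i)) = (\<Sum>j\<le>K. exp (x * ((real K)\<^sup>2 - (real j)\<^sup>2)) * f j)"
begin

abbreviation B :: real where "B \<equiv> (real K)\<^sup>2 + 1"

text \<open>The contribution of grade \<open>j\<close> to the partition sum, without the common factor
  \<open>exp (x (K\<^sup>2 + \<theta> B))\<close>.\<close>

definition theta_term :: "real \<Rightarrow> nat \<Rightarrow> real" where "theta_term \<theta> j = exp (x * (\<theta> * j - (real j)\<^sup>2))"

definition grade_prob :: "real \<Rightarrow> nat \<Rightarrow> real" where "grade_prob \<theta> j = theta_term \<theta> j / (\<Sum>j\<le>K. theta_term \<theta> j)"

lemma log_slope_grade: "i < q \<Longrightarrow> log_slope i = x * (B + grade i)"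
  by (simp add: log_slope_def length_eq)

lemma sum_theta_term_pos: "0 < (\<Sum>j\<le>K. theta_term \<theta> j)"
  by (intro sum_pos) (auto simp: theta_term_def)

lemma partition_sum_theta: "partition_sum \<theta> = exp (x * ((real K)\<^sup>2 + \<theta> * B)) * (\<Sum>j\<le>K. theta_term \<theta> j)"
proof -
  have "partition_sum \<theta> = (\<Sum>i<q. exp (\<theta> * (x * (B + grade i))))"
    unfolding partition_sum_def by (intro sum.cong) (auto simp: log_slope_grade)
  also have "\<dots> = (\<Sum>j\<le>K. exp (x * ((real K)\<^sup>2 - (real j)\<^sup>2)) * exp (\<theta> * (x * (B + j))))"
    by (rule sum_grade)
  also have "\<dots> = (\<Sum>j\<le>K. exp (x * ((real K)\<^sup>2 + \<theta> * B)) * theta_term \<theta> j)"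
    by (intro sum.cong) (auto simp: theta_term_def algebra_simps simp flip: exp_add)
  finally show ?thesis by (simp add: sum_distrib_left)
qed

lemma pressure_theta: "pressure \<theta> = x * ((real K)\<^sup>2 + \<theta> * B) + ln (\<Sum>j\<le>K. theta_term \<theta> j)"
  using sum_theta_term_pos[of \<theta>] by (simp add: pressure_def partition_sum_theta ln_mult)

lemma sum_weight_grade: "(\<Sum>i<q. weight \<theta> i * f (log_slope i)) = (\<Sum>j\<le>K. grade_prob \<theta> j * f (x * (B + j)))"
proof -
  have "(\<Sum>i<q. weight \<theta> i * f (log_slope i))
      = (\<Sum>i<q. exp (\<theta> * (x * (B + grade i))) / partition_sum \<theta> * f (x * (B + grade i)))"
    by (intro sum.cong) (auto simp: log_slope_grade weight_def)
  also have "\<dots> = (\<Sum>j\<le>K. exp (x * ((real K)\<^sup>2 - (real j)\<^sup>2)) * (exp (\<theta> * (x * (B + j))) / partition_sum \<theta> * f (x * (B + j))))"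
    by (rule sum_grade)
  also have "\<dots> = (\<Sum>j\<le>K. grade_prob \<theta> j * f (x * (B + j)))"
  proof (intro sum.cong refl)
    fix j
    have "exp (x * ((real K)\<^sup>2 - (real j)\<^sup>2)) * exp (\<theta> * (x * (B + j))) = exp (x * ((real K)\<^sup>2 + \<theta> * B)) * theta_term \<theta> j"
      by (simp add: theta_term_def algebra_simps flip: exp_add)
    then have eq: "exp (x * ((real K)\<^sup>2 - (real j)\<^sup>2)) * exp (\<theta> * (x * (B + j))) / partition_sum \<theta> = grade_prob \<theta> j"
      by (simp add: grade_prob_def partition_sum_theta)
    show "exp (x * ((real K)\<^sup>2 - (real j)\<^sup>2)) * (exp (\<theta> * (x * (B + j))) / partition_sum \<theta> * f (x * (B + j)))
        = grade_prob \<theta> j * f (x * (B + j))" by (subst eq [symmetric]) simp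
  qed
  finally show ?thesis .
qed

lemma grade_prob_pos: "0 < grade_prob \<theta> j"
  using sum_theta_term_pos by (simp add: grade_prob_def theta_term_def)

lemma sum_grade_prob: "(\<Sum>j\<le>K. grade_prob \<theta> j) = 1"
  using sum_theta_term_pos[of \<theta>] by (simp add: grade_prob_def flip: sum_divide_distrib)

lemma mean_exponent_grade: "mean_exponent \<theta> = (\<Sum>j\<le>K. grade_prob \<theta> j * (x * (B + j)))"
  unfolding mean_exponent_def by (rule sum_weight_grade)

lemma variance_grade: "variance \<theta> = (\<Sum>j\<le>K. grade_prob \<theta> j * (x * (B + j) - mean_exponent \<theta>)\<^sup>2)"
  unfolding variance_def by (rule sum_weight_grade)

lemma mean_exponent_bounds: "x \<le> mean_exponent \<theta>" "mean_exponent \<theta> \<le> x * (B + K)"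
proof -
  have "(\<Sum>j\<le>K. grade_prob \<theta> j * x) \<le> mean_exponent \<theta>" unfolding mean_exponent_grade
    using x grade_prob_pos by (intro sum_mono mult_left_mono) (auto intro: less_imp_le)
  then show "x \<le> mean_exponent \<theta>" by (simp add: sum_grade_prob flip: sum_distrib_right)
  have "mean_exponent \<theta> \<le> (\<Sum>j\<le>K. grade_prob \<theta> j * (x * (B + K)))" unfolding mean_exponent_grade
    using x grade_prob_pos by (intro sum_mono mult_left_mono) (auto intro: less_imp_le)
  then show "mean_exponent \<theta> \<le> x * (B + K)" by (simp add: sum_grade_prob flip: sum_distrib_right)
qed

lemma sum_theta_term_le:
  fixes c :: real
  assumes "\<And>j. theta_term \<theta> j \<le> c"
  shows "(\<Sum>j\<le>K. theta_term \<theta> j) \<le> (K + 1) * c"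
  using sum_bounded_above[of "{..K}" "theta_term \<theta>" c] assms by (simp add: add.commute)

text \<open>Relative to the term \<open>j = i\<close>, the term \<open>j\<close> of the theta series is \<open>exp (- x (j - i)\<^sup>2)\<close>. So all but a
  fraction of order \<open>exp (- x)\<close> of the weight sits on one exponent, and the variance is of
  order \<open>x\<^sup>2 exp (- x)\<close>. The factor \<open>exp (- x)\<close> absorbs the pressure, which grows linearly in \<open>x\<close>, and
  \<open>A\<^sup>2\<close> is at least \<open>x\<^sup>2\<close>.\<close>

lemma below_at_even:
  assumes i: "i \<le> K" and small: "2 * ((2 * (real K)\<^sup>2 + 2 * K * B) * x + (K + 1)) * ((K + 1) * (real K)\<^sup>2) * exp (- x) < 1"
  shows "2 * pressure (2 * i) * variance (2 * i) < (mean_exponent (2 * i))\<^sup>2"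
proof -
  let ?\<theta> = "2 * real i"
  have theta_term: "theta_term ?\<theta> j = theta_term ?\<theta> i * exp (- x * (real j - real i)\<^sup>2)" for j
    by (simp add: theta_term_def power2_eq_square algebra_simps flip: exp_add)
  have ui: "theta_term ?\<theta> i = exp (x * (real i)\<^sup>2)" by (simp add: theta_term_def power2_eq_square)
  have u_le: "theta_term ?\<theta> j \<le> theta_term ?\<theta> i" for j
    unfolding theta_term[of j] using x by (intro mult_left_le) (auto simp: theta_term_def)
  have "ln (\<Sum>j\<le>K. theta_term ?\<theta> j) \<le> ln ((K + 1) * exp (x * (real i)\<^sup>2))"
    using sum_theta_term_le[OF u_le] sum_theta_term_pos[of ?\<theta>] by (simp add: ui)
  also have "\<dots> = ln (K + 1) + x * (real i)\<^sup>2" by (simp add: ln_mult)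
  also have "ln (K + 1) \<le> K + 1" using ln_le_minus_one[of "K + 1"] by simp
  finally have "pressure ?\<theta> \<le> x * ((real K)\<^sup>2 + 2 * i * B + (real i)\<^sup>2) + (K + 1)"
    by (simp add: pressure_theta algebra_simps)
  also have "\<dots> \<le> x * ((real K)\<^sup>2 + 2 * K * B + (real K)\<^sup>2) + (K + 1)"
    using i x by (intro add_right_mono mult_left_mono add_mono power_mono mult_right_mono) auto
  also have "\<dots> = (2 * (real K)\<^sup>2 + 2 * K * B) * x + (K + 1)" by (simp add: algebra_simps)
  finally have P: "pressure ?\<theta> \<le> (2 * (real K)\<^sup>2 + 2 * K * B) * x + (K + 1)" (is "_ \<le> ?P") .
  have dev: "grade_prob ?\<theta> j * (x * (B + j) - x * (B + i))\<^sup>2 \<le> x\<^sup>2 * (real K)\<^sup>2 * exp (- x)" if j: "j \<le> K" for j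
  proof (cases "j = i")
    case True
    then show ?thesis by simp
  next
    case False
    have "1 \<le> \<bar>real j - real i\<bar>" using False by linarith
    then have one: "1 \<le> (real j - real i)\<^sup>2" by (simp add: abs_le_square_iff [of 1, simplified])
    have "\<bar>real j - real i\<bar> \<le> \<bar>real K\<bar>" using i j by linarith
    then have sq: "(real j - real i)\<^sup>2 \<le> (real K)\<^sup>2" by (simp only: abs_le_square_iff)
    have "theta_term ?\<theta> i \<le> (\<Sum>j\<le>K. theta_term ?\<theta> j)" using i by (intro member_le_sum) (auto simp: theta_term_def)
    then have "grade_prob ?\<theta> j \<le> theta_term ?\<theta> j / theta_term ?\<theta> i"
      unfolding grade_prob_def by (intro divide_left_mono) (auto simp: theta_term_def intro!: mult_pos_pos sum_pos)
    also have "\<dots> = exp (- x * (real j - real i)\<^sup>2)" by (subst theta_term) (simp add: theta_term_def)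
    also have "\<dots> \<le> exp (- x)" using one x by simp
    finally have "grade_prob ?\<theta> j \<le> exp (- x)" .
    then have "grade_prob ?\<theta> j * (real j - real i)\<^sup>2 \<le> exp (- x) * (real K)\<^sup>2"
      using sq by (intro mult_mono) auto
    then have "x\<^sup>2 * (grade_prob ?\<theta> j * (real j - real i)\<^sup>2) \<le> x\<^sup>2 * (exp (- x) * (real K)\<^sup>2)"
      by (rule mult_left_mono) simp
    moreover have "(x * (B + j) - x * (B + i))\<^sup>2 = x\<^sup>2 * (real j - real i)\<^sup>2"
      by (simp add: power_mult_distrib flip: right_diff_distrib)
    ultimately show ?thesis by (simp add: mult_ac)
  qed
  have "variance ?\<theta> \<le> (\<Sum>j\<le>K. grade_prob ?\<theta> j * (x * (B + j) - x * (B + i))\<^sup>2)"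
    unfolding variance_grade mean_exponent_grade by (rule sum_square_deviation_ge[OF sum_grade_prob])
  also have "\<dots> \<le> (\<Sum>j\<le>K. x\<^sup>2 * (real K)\<^sup>2 * exp (- x))" by (intro sum_mono dev) auto
  finally have V: "variance ?\<theta> \<le> x\<^sup>2 * ((K + 1) * (real K)\<^sup>2 * exp (- x))" by (simp add: algebra_simps)
  have "0 \<le> variance ?\<theta>"
    unfolding variance_grade using grade_prob_pos by (intro sum_nonneg) (auto intro!: mult_nonneg_nonneg intro: less_imp_le)
  then have "pressure ?\<theta> * variance ?\<theta> \<le> ?P * variance ?\<theta>" using P by (intro mult_right_mono)
  also have "\<dots> \<le> ?P * (x\<^sup>2 * ((K + 1) * (real K)\<^sup>2 * exp (- x)))"
    using V x by (intro mult_left_mono) auto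
  finally have "2 * (pressure ?\<theta> * variance ?\<theta>) \<le> 2 * (?P * (x\<^sup>2 * ((K + 1) * (real K)\<^sup>2 * exp (- x))))"
    by (rule mult_left_mono) simp
  then have "2 * pressure ?\<theta> * variance ?\<theta> \<le> x\<^sup>2 * (2 * ?P * ((K + 1) * (real K)\<^sup>2) * exp (- x))"
    by (simp only: mult_ac)
  also have "\<dots> < x\<^sup>2 * 1" using small x by (intro mult_strict_left_mono) auto
  also have "\<dots> \<le> (mean_exponent ?\<theta>)\<^sup>2" using mean_exponent_bounds(1) x by (simp add: power_mono)
  finally show ?thesis by simp
qed

text \<open>Relative to the term \<open>j = i\<close>, the term \<open>j\<close> is now \<open>exp (- x (j - i) (j - i - 1))\<close>. The terms \<open>i\<close> and
  \<open>i + 1\<close> are equal and maximal, so each carries at least the share \<open>1 / (K + 1)\<close> of the weight. Their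
  exponents differ by \<open>x\<close>, which keeps the variance of order \<open>x\<^sup>2\<close>; thus \<open>2 P V\<close> is cubic in \<open>x\<close> and
  \<open>A\<^sup>2\<close> only quadratic.\<close>

lemma above_at_odd:
  assumes i: "i < K" and large: "(K + 1) * (B + K)\<^sup>2 < x"
  shows "(mean_exponent (2 * i + 1))\<^sup>2 < 2 * pressure (2 * i + 1) * variance (2 * i + 1)"
proof -
  let ?\<theta> = "2 * real i + 1" and ?\<mu> = "mean_exponent (2 * real i + 1)"
  have theta_term: "theta_term ?\<theta> j = theta_term ?\<theta> i * exp (- x * ((real j - real i) * (real j - real i - 1)))" for j
    by (simp add: theta_term_def power2_eq_square algebra_simps flip: exp_add)
  have "0 \<le> (real j - real i) * (real j - real i - 1)" for j
    by (cases "j \<le> i") (auto simp: mult_nonneg_nonneg mult_nonpos_nonpos)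
  then have u_le: "theta_term ?\<theta> j \<le> theta_term ?\<theta> i" for j
    unfolding theta_term[of j] using x by (intro mult_left_le) (auto simp: theta_term_def)
  have "(\<Sum>j\<le>K. theta_term ?\<theta> j) \<le> (K + 1) * theta_term ?\<theta> i" by (rule sum_theta_term_le[OF u_le])
  then have pi: "1 / (K + 1) \<le> grade_prob ?\<theta> i"
    using sum_theta_term_pos[of ?\<theta>] by (simp add: grade_prob_def divide_simps mult.commute)
  have "theta_term ?\<theta> (Suc i) = theta_term ?\<theta> i" by (subst theta_term) simp
  then have pi': "1 / (K + 1) \<le> grade_prob ?\<theta> (Suc i)" using pi by (simp add: grade_prob_def)
  \<comment> \<open>The two exponents deviate from the mean by \<open>d\<close> and \<open>d + x\<close>, which cannot both be small.\<close>
  define d where "d = x * (B + i) - ?\<mu>"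
  have "x\<^sup>2 / 2 \<le> d\<^sup>2 + (d + x)\<^sup>2"
    using zero_le_power2[of "2 * d + x"] by (simp add: power2_eq_square algebra_simps)
  then have "1 / (K + 1) * (x\<^sup>2 / 2) \<le> 1 / (K + 1) * (d\<^sup>2 + (d + x)\<^sup>2)"
    by (rule mult_left_mono) simp
  also have "\<dots> = 1 / (K + 1) * d\<^sup>2 + 1 / (K + 1) * (d + x)\<^sup>2" by (rule distrib_left)
  also have "\<dots> \<le> grade_prob ?\<theta> i * d\<^sup>2 + grade_prob ?\<theta> (Suc i) * (d + x)\<^sup>2"
    using pi pi' by (intro add_mono mult_right_mono) auto
  also have "\<dots> = (\<Sum>j\<in>{i, Suc i}. grade_prob ?\<theta> j * (x * (B + j) - ?\<mu>)\<^sup>2)"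
    by (simp add: d_def algebra_simps)
  also have "\<dots> \<le> variance ?\<theta>"
    unfolding variance_grade using i grade_prob_pos
    by (intro sum_mono2) (auto intro!: mult_nonneg_nonneg intro: less_imp_le)
  finally have V: "x\<^sup>2 / (2 * (K + 1)) \<le> variance ?\<theta>" by (simp add: algebra_simps)
  have "theta_term ?\<theta> 0 \<le> (\<Sum>j\<le>K. theta_term ?\<theta> j)" by (intro member_le_sum) (auto simp: theta_term_def)
  then have "0 \<le> ln (\<Sum>j\<le>K. theta_term ?\<theta> j)" by (simp add: theta_term_def)
  moreover have "1 \<le> (real K)\<^sup>2 + ?\<theta> * B"
    by (simp add: algebra_simps add_nonneg_nonneg)
  then have "x * 1 \<le> x * ((real K)\<^sup>2 + ?\<theta> * B)" using x by (intro mult_left_mono) auto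
  ultimately have P: "x \<le> pressure ?\<theta>" unfolding pressure_theta by simp
  have "?\<mu>\<^sup>2 \<le> (x * (B + K))\<^sup>2"
    using mean_exponent_bounds[of ?\<theta>] x by (intro power_mono) auto
  also have "\<dots> = x\<^sup>2 / (K + 1) * ((K + 1) * (B + K)\<^sup>2)"
    by (simp add: power_mult_distrib)
  also have "\<dots> < x\<^sup>2 / (K + 1) * x" using large x by (intro mult_strict_left_mono) auto
  also have "\<dots> = 2 * (x * (x\<^sup>2 / (2 * (K + 1))))" by (simp add: field_simps)
  also have "\<dots> \<le> 2 * (pressure ?\<theta> * variance ?\<theta>)"
    using P V x by (intro mult_left_mono mult_mono) auto
  finally show ?thesis by (simp add: mult.assoc)
qed

end

section \<open>Many inflection points\<close>

text \<open>Numbers the disjoint union of \<open>N j\<close> copies of each grade \<open>j\<close>, as branches are indexed by an initial segment of the naturals.\<close>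

lemma reindex_multiplicities:
  fixes N :: "nat \<Rightarrow> nat"
  obtains g where "\<And>f :: nat \<Rightarrow> real. (\<Sum>i<(\<Sum>j\<le>K. N j). f (g i)) = (\<Sum>j\<le>K. N j * f j)"
    and "g ` {..<(\<Sum>j\<le>K. N j)} = {j. j \<le> K \<and> N j > 0}"
proof -
  define I where "I = Sigma {..K} (\<lambda>j. {..<N j})"
  have fin: "finite I" and card: "card I = (\<Sum>j\<le>K. N j)" by (auto simp: I_def)
  obtain h where h: "bij_betw h {..<card I} I"
    using ex_bij_betw_nat_finite[OF fin] by (auto simp: lessThan_atLeast0)
  show thesis
  proof (rule that[of "fst \<circ> h"])
    fix f :: "nat \<Rightarrow> real"
    have "(\<Sum>i<card I. f ((fst \<circ> h) i)) = (\<Sum>p\<in>I. f (fst p))"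
      using sum.reindex_bij_betw[OF h, of "\<lambda>p. f (fst p)"] by simp
    also have "\<dots> = (\<Sum>j\<le>K. \<Sum>l<N j. f j)"
      unfolding I_def by (subst sum.Sigma) (auto simp: case_prod_beta)
    finally show "(\<Sum>i<(\<Sum>j\<le>K. N j). f ((fst \<circ> h) i)) = (\<Sum>j\<le>K. N j * f j)" by (simp add: card)
    have "(fst \<circ> h) ` {..<card I} = fst ` I" by (simp only: image_comp [symmetric] bij_betw_imp_surj_on[OF h])
    also have "\<dots> = {j. j \<le> K \<and> N j > 0}" by (force simp: I_def image_iff)
    finally show "(fst \<circ> h) ` {..<(\<Sum>j\<le>K. N j)} = {j. j \<le> K \<and> N j > 0}" by (simp add: card)
  qed
qed

lemma eventually_affine_exp_less:
  fixes c d e :: real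
  assumes "e > 0"
  shows "eventually (\<lambda>x. (c * x + d) * exp (- x) < e) at_top"
proof -
  have "((\<lambda>x::real. c * (x ^ 1 / exp x) + d * (x ^ 0 / exp x)) \<longlongrightarrow> c * 0 + d * 0) at_top"
    by (intro tendsto_intros tendsto_power_div_exp_0)
  then have "((\<lambda>x. (c * x + d) * exp (- x)) \<longlongrightarrow> 0) at_top"
    by (simp add: exp_minus divide_inverse algebra_simps)
  then show ?thesis using assms by (rule order_tendstoD(2))
qed

text \<open>The parameter is taken to be \<open>x = ln m\<close> with \<open>m\<close> a natural number, since then the multiplicities
  \<open>m ^ (K\<^sup>2 - j\<^sup>2)\<close> are integers. A large \<open>m\<close> meets the sign conditions at even and odd nodes and makes the
  total length smaller than \<open>1\<close>. Since \<open>2 K\<close> inflection points result, \<open>K = n + 1\<close> is ample; being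
  positive, it also guarantees two different lengths.\<close>

theorem theorem1p4:
  fixes n :: nat
  shows "\<exists>(q :: nat) (X :: nat \<Rightarrow> real set) (T :: real \<Rightarrow> real).
           piecewise_linear_map q X T \<and>
           (\<exists>S. S \<subseteq> inflection_points (\<Union>i<q. X i) T \<and> finite S \<and> card S \<ge> n)"
proof -
  define K where "K = n + 1"
  define B :: real where "B = (real K)\<^sup>2 + 1"
  define c where "c = 2 * ((K + 1) * (real K)\<^sup>2)"
  \<comment> \<open>The conditions are, in order: the even nodes, total length below \<open>1\<close>, the odd nodes, and \<open>m \<ge> 2\<close>.\<close>
  have "eventually (\<lambda>x. (c * (2 * (real K)\<^sup>2 + 2 * real K * B) * x + c * (real K + 1)) * exp (- x) < 1 \<and>
      (0 * x + (real K + 1)) * exp (- x) < 1 \<and> (real K + 1) * (B + K)\<^sup>2 < x \<and> 1 < x) at_top"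
    by (intro eventually_conj eventually_affine_exp_less eventually_gt_at_top) auto
  moreover have "filterlim (\<lambda>m::nat. ln (real m)) at_top at_top"
    by (rule filterlim_compose[OF ln_at_top filterlim_real_sequentially])
  ultimately have "eventually (\<lambda>m::nat. let x = ln (real m) in
      (c * (2 * (real K)\<^sup>2 + 2 * real K * B) * x + c * (real K + 1)) * exp (- x) < 1 \<and>
      (0 * x + (real K + 1)) * exp (- x) < 1 \<and> (real K + 1) * (B + K)\<^sup>2 < x \<and> 1 < x) sequentially"
    unfolding Let_def by (rule eventually_compose_filterlim)
  then obtain m :: nat where m: "let x = ln (real m) in
      (c * (2 * (real K)\<^sup>2 + 2 * real K * B) * x + c * (real K + 1)) * exp (- x) < 1 \<and>
      (0 * x + (real K + 1)) * exp (- x) < 1 \<and> (real K + 1) * (B + K)\<^sup>2 < x \<and> 1 < x"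
    unfolding eventually_sequentially by blast
  define x where "x = ln (real m)"
  have small: "2 * ((2 * (real K)\<^sup>2 + 2 * K * B) * x + (K + 1)) * ((K + 1) * (real K)\<^sup>2) * exp (- x) < 1"
    and mass: "(real K + 1) * exp (- x) < 1" and large: "(real K + 1) * (B + K)\<^sup>2 < x" and x: "1 < x"
    using m by (auto simp: Let_def x_def c_def algebra_simps)
  have m2: "m \<ge> 2"
  proof (rule ccontr)
    assume "\<not> m \<ge> 2"
    then have "m = 0 \<or> m = 1" by auto
    then show False using x by (auto simp: x_def)
  qed
  then have exp_x: "real m = exp x" by (simp add: x_def)
  define N where "N j = m ^ (K\<^sup>2 - j\<^sup>2)" for j
  have N: "real (N j) = exp (x * ((real K)\<^sup>2 - (real j)\<^sup>2))" if "j \<le> K" for j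
    using that by (simp add: N_def exp_x of_nat_diff power_mono mult.commute flip: exp_of_nat_mult)
  have N_pos: "N j > 0" for j using m2 by (simp add: N_def)
  define q where "q = (\<Sum>j\<le>K. N j)"
  obtain g where g: "\<And>f :: nat \<Rightarrow> real. (\<Sum>i<q. f (g i)) = (\<Sum>j\<le>K. N j * f j)"
    and range_g: "g ` {..<q} = {j. j \<le> K \<and> N j > 0}"
    unfolding q_def using reindex_multiplicities by blast
  have sum_g: "(\<Sum>i<q. f (g i)) = (\<Sum>j\<le>K. exp (x * ((real K)\<^sup>2 - (real j)\<^sup>2)) * f j)" for f :: "nat \<Rightarrow> real"
    unfolding g by (intro sum.cong) (auto simp: N)
  define r where "r i = exp (- (x * ((real K)\<^sup>2 + 1 + g i)))" for i
  have "(\<Sum>i<q. r i) = (\<Sum>j\<le>K. exp (x * ((real K)\<^sup>2 - (real j)\<^sup>2)) * exp (- (x * ((real K)\<^sup>2 + 1 + j))))"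
    unfolding r_def by (rule sum_g[of "\<lambda>j. exp (- (x * ((real K)\<^sup>2 + 1 + j)))"])
  also have "\<dots> \<le> (\<Sum>j\<le>K. exp (- x))"
    using x by (intro sum_mono) (simp add: algebra_simps flip: exp_add)
  also have "\<dots> < 1" using mass by (simp add: add.commute)
  finally have sum_r: "(\<Sum>i<q. r i) < 1" .
  obtain i where i: "i < q" "g i = 0" using range_g N_pos by (force simp: set_eq_iff image_iff)
  obtain j where j: "j < q" "g j = 1" using range_g N_pos by (force simp: set_eq_iff image_iff K_def)
  interpret theta_branch_lengths q r K x g
  proof
    have "i \<noteq> j" using i j by auto
    then show "2 \<le> q" using i j by linarith
  qed (use sum_r sum_g x in \<open>auto simp: r_def K_def\<close>)
  interpret nonuniform_branch_lengths q r
    by unfold_locales (use i j x in \<open>force simp: r_def\<close>)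
  have "\<exists>S. S \<subseteq> inflection_points D T \<and> finite S \<and> card S \<ge> 2 * K"
  proof (rule many_inflection_points[of real])
    show "strict_mono real" by (simp add: strict_mono_def)
    fix k assume k: "k \<le> 2 * K"
    show "0 < (- 1) ^ k * ((mean_exponent (real k))\<^sup>2 - 2 * pressure (real k) * variance (real k))"
    proof (cases "even k")
      case True
      then obtain i where "k = 2 * i" by blast
      then show ?thesis using below_at_even[of i] small k by (simp add: B_def)
    next
      case False
      then obtain i where "k = 2 * i + 1" by (auto elim: oddE)
      then show ?thesis using above_at_odd[of i] large k by (simp add: B_def add.commute)
    qed
  qed
  then obtain S where "S \<subseteq> inflection_points D T" "finite S" "card S \<ge> 2 * K" by blast
  moreover have "n \<le> 2 * K" by (simp add: K_def)
  ultimately show ?thesis using piecewise_linear by (meson order_trans)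
qed

end
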